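(* Let $l\ge1$, let $m=(m_{i,j})_{1\le i<j\le l+1}$ be positive integers, and let $v$ be the polynomial in $q_1,\ldots,q_l$ which equals the volume function $v_{l,m}(h)$ of the flow polytope for $h=q_1\alpha_1+\cdots+q_l\alpha_l$ in the nice chamber $\mathfrak{c}_{\rm nice}$. Then the ideal $$\mathrm{Ann}(v)=\{D\in\mathbb{R}[\partial_1,\ldots,\partial_l]\mid Dv=0\},\qquad \partial_i=\frac{\partial}{\partial q_i},$$ is generated by the $l$ differential operators $$\partial_l^{m_{l,l+1}},\quad \partial_{l-1}^{m_{l-1,l}}(\partial_{l-1}+\partial_l)^{m_{l-1,l+1}},\quad\ldots,\quad \partial_1^{m_{1,2}}(\partial_1+\partial_2)^{m_{1,3}}\cdots(\partial_1+\cdots+\partial_l)^{m_{1,l+1}},$$ that is, by $\prod_{j=i+1}^{l+1}(\partial_i+\partial_{i+1}+\cdots+\partial_{j-1})^{m_{i,j}}$ for $1\le i\le l$.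
   Context: Let $e_1,\ldots,e_{l+1}$ be the standard basis of $\mathbb{R}^{l+1}$, $\alpha_i=e_i-e_{i+1}$ $(1\le i\le l)$, $C(A_l^+)=\{q_1\alpha_1+\cdots+q_l\alpha_l\mid q_i\in\mathbb{R}_{\ge0}\}$, and $M=\sum_{1\le i<j\le l+1}m_{i,j}$. For $h\in C(A_l^+)$ the flow polytope is $$P_{l,m}(h)=\Bigl\{(x_{i,j}^k)_{1\le i<j\le l+1,\,1\le k\le m_{i,j}}\in\mathbb{R}^M\ \Big|\ x_{i,j}^k\ge0,\ \sum_{i<j}\sum_k x_{i,j}^k(e_i-e_j)=h\Bigr\}.$$ Its volume $v_{l,m}(h)$ is a piecewise polynomial function on $C(A_l^+)$, normalized by the integer lattice in the affine subspace, so that $v_{l,m}(h)=\lim_{k\to\infty}k^{-(M-l)}|P_{l,m}(kh)\cap\mathbb{Z}^M|$ for $h\in C(A_l^+)\cap\sum_i\mathbb{Z}\alpha_i$. The nice chamber is the open set $\mathfrak{c}_{\rm nice}=\{q_1\alpha_1+\cdots+q_l\alpha_l\mid 0<q_1<q_2<\cdots<q_l\}$; on it $v_{l,m}$ is given by a single homogeneous polynomial of degree $M-l$ in $q_1,\ldots,q_l$. *)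

theory Defs
  imports
    "HOL-Analysis.Analysis"
    "HOL-Algebra.Ideal"
    "HOL-Library.Poly_Mapping"
begin

section \<open>Polynomials in finitely many variables and constant coefficient differential operators\<close>

text \<open>A real polynomial in variables indexed by natural numbers: exponent vectors are finitely
  supported maps from variable indices to exponents, polynomials are finitely supported maps from
  exponent vectors to coefficients, and the multiplication is convolution.\<close>

type_synonym mpolynomial = "(nat \<Rightarrow>\<^sub>0 nat) \<Rightarrow>\<^sub>0 real"

definition mconst :: "real \<Rightarrow> mpolynomial" where
  "mconst c = Poly_Mapping.single 0 c"

definition mvar :: "nat \<Rightarrow> mpolynomial" where
  "mvar i = Poly_Mapping.single (Poly_Mapping.single i 1) 1"

definition mvars :: "mpolynomial \<Rightarrow> nat set" where
  "mvars p = (\<Union>a\<in>Poly_Mapping.keys p. Poly_Mapping.keys a)"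

definition meval :: "(nat \<Rightarrow> real) \<Rightarrow> mpolynomial \<Rightarrow> real" where
  "meval q p = (\<Sum>a\<in>Poly_Mapping.keys p.
     Poly_Mapping.lookup p a * (\<Prod>i\<in>Poly_Mapping.keys a. q i ^ Poly_Mapping.lookup a i))"

text \<open>The polynomial ring over the reals in the variables with indices \<open>1, \<dots>, l\<close>. It serves both
  for polynomials in \<open>q\<^sub>1, \<dots>, q\<^sub>l\<close> and for polynomials in the symbols \<open>\<partial>\<^sub>1, \<dots>, \<partial>\<^sub>l\<close>.\<close>

definition mpoly_ring :: "nat \<Rightarrow> mpolynomial ring" where
  "mpoly_ring l =
     \<lparr>carrier = {p. mvars p \<subseteq> {1..l}}, monoid.mult = (*), one = 1, ring.zero = 0, add = (+)\<rparr>"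

definition mderiv :: "nat \<Rightarrow> mpolynomial \<Rightarrow> mpolynomial" where
  "mderiv i p = (\<Sum>a\<in>Poly_Mapping.keys p.
     Poly_Mapping.single (a - Poly_Mapping.single i 1)
       (of_nat (Poly_Mapping.lookup a i) * Poly_Mapping.lookup p a))"

definition monom_op :: "(nat \<Rightarrow>\<^sub>0 nat) \<Rightarrow> mpolynomial \<Rightarrow> mpolynomial" where
  "monom_op a =
     fold (\<lambda>i. mderiv i ^^ Poly_Mapping.lookup a i) (sorted_list_of_set (Poly_Mapping.keys a))"

text \<open>The action of \<open>D\<close>, read as a polynomial in the \<open>\<partial>\<^sub>i\<close> (the symbol \<open>\<partial>\<^sub>i\<close> is \<open>mvar i\<close>),
  on a polynomial in the \<open>q\<^sub>i\<close>.\<close>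

definition diffop :: "mpolynomial \<Rightarrow> mpolynomial \<Rightarrow> mpolynomial" where
  "diffop D p =
     (\<Sum>a\<in>Poly_Mapping.keys D. mconst (Poly_Mapping.lookup D a) * monom_op a p)"

definition Ann :: "nat \<Rightarrow> mpolynomial \<Rightarrow> mpolynomial set" where
  "Ann l v = {D \<in> carrier (mpoly_ring l). diffop D v = 0}"

section \<open>Flow polytopes and their volume\<close>

text \<open>Vectors of \<open>\<real>\<^sup>l\<^sup>+\<^sup>1\<close> are functions that vanish outside \<open>{1..l+1}\<close>.\<close>

definition unit_vec :: "nat \<Rightarrow> nat \<Rightarrow> real" where
  "unit_vec i = (\<lambda>t. if t = i then 1 else 0)"

definition simple_root :: "nat \<Rightarrow> nat \<Rightarrow> real" where
  "simple_root i = (\<lambda>t. unit_vec i t - unit_vec (i + 1) t)"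

definition root_comb :: "nat \<Rightarrow> (nat \<Rightarrow> real) \<Rightarrow> nat \<Rightarrow> real" where
  "root_comb l q = (\<lambda>t. \<Sum>i = 1..l. q i * simple_root i t)"

text \<open>The nice chamber in the coordinates \<open>q\<close> of \<open>root_comb l q\<close>;
  only the values of \<open>q\<close> on \<open>{1..l}\<close> matter.\<close>

definition nice_coords :: "nat \<Rightarrow> (nat \<Rightarrow> real) set" where
  "nice_coords l = {q. 0 < q 1 \<and> (\<forall>i. 1 \<le> i \<and> i < l \<longrightarrow> q i < q (i + 1))}"

type_synonym flow = "nat \<times> nat \<times> nat \<Rightarrow> real"

definition flow_index :: "nat \<Rightarrow> (nat \<Rightarrow> nat \<Rightarrow> nat) \<Rightarrow> (nat \<times> nat \<times> nat) set" where
  "flow_index l m = {(i, j, k). 1 \<le> i \<and> i < j \<and> j \<le> l + 1 \<and> 1 \<le> k \<and> k \<le> m i j}"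

text \<open>The affine subspace of \<open>\<real>\<^sup>M\<close> containing the flow polytope; elements of \<open>\<real>\<^sup>M\<close> are functions
  that vanish outside the \<open>M\<close>-element set \<open>flow_index l m\<close>.\<close>

definition flow_space :: "nat \<Rightarrow> (nat \<Rightarrow> nat \<Rightarrow> nat) \<Rightarrow> (nat \<Rightarrow> real) \<Rightarrow> flow set" where
  "flow_space l m h = {x. (\<forall>e. e \<notin> flow_index l m \<longrightarrow> x e = 0) \<and>
     (\<forall>t. (\<Sum>(i, j, k)\<in>flow_index l m. x (i, j, k) * (unit_vec i t - unit_vec j t)) = h t)}"

definition flow_polytope :: "nat \<Rightarrow> (nat \<Rightarrow> nat \<Rightarrow> nat) \<Rightarrow> (nat \<Rightarrow> real) \<Rightarrow> flow set" where
  "flow_polytope l m h = {x \<in> flow_space l m h. \<forall>e\<in>flow_index l m. 0 \<le> x e}"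

text \<open>The integer lattice in the linear space parallel to \<open>flow_space l m h\<close>.\<close>

definition flow_lattice :: "nat \<Rightarrow> (nat \<Rightarrow> nat \<Rightarrow> nat) \<Rightarrow> flow set" where
  "flow_lattice l m = {x \<in> flow_space l m (\<lambda>t. 0). \<forall>e. x e \<in> \<int>}"

definition is_lattice_basis :: "flow set \<Rightarrow> nat \<Rightarrow> (nat \<Rightarrow> flow) \<Rightarrow> bool" where
  "is_lattice_basis L d b \<longleftrightarrow>
     bij_betw (\<lambda>c e. \<Sum>r<d. of_int (c r) * b r e) ({..<d} \<rightarrow>\<^sub>E (UNIV :: int set)) L"

text \<open>\<open>V\<close> is the volume of the flow polytope for \<open>h\<close>, normalized by the integer lattice: the
  Lebesgue measure of the polytope in affine coordinates on \<open>flow_space l m h\<close> given by an origin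
  \<open>x0\<close> and a \<open>\<int>\<close>-basis \<open>b\<close> of the lattice. Two such coordinate systems differ by a translation
  and a matrix of determinant \<open>\<plusminus>1\<close>, so the value is the same in all of them.\<close>

definition has_flow_volume ::
  "nat \<Rightarrow> (nat \<Rightarrow> nat \<Rightarrow> nat) \<Rightarrow> (nat \<Rightarrow> real) \<Rightarrow> real \<Rightarrow> bool" where
  "has_flow_volume l m h V \<longleftrightarrow>
     (\<forall>d b x0. is_lattice_basis (flow_lattice l m) d b \<and> x0 \<in> flow_space l m h \<longrightarrow>
        measure (\<Pi>\<^sub>M r\<in>{..<d}. lborel)
          {c \<in> {..<d} \<rightarrow>\<^sub>E UNIV.
             (\<lambda>e. x0 e + (\<Sum>r<d. c r * b r e)) \<in> flow_polytope l m h} = V)"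

end

theory Submission imports Defs begin

text \<open>
  Read \<open>h = \<Sum> q\<^sub>i \<alpha>\<^sub>i\<close> as a demand on the vertices \<open>1, \<dots>, l + 1\<close> of a directed multigraph with
  \<open>m i j\<close> edges \<open>i \<rightarrow> j\<close>. In the coordinates \<open>h\<^sub>i = q\<^sub>i - q\<^sub>i\<^sub>-\<^sub>1\<close> the nice chamber is the positive
  orthant: every vertex but the sink \<open>l + 1\<close> is a source. Flows can then be built vertex by vertex.
  Send \<open>x\<close> along an edge \<open>i \<rightarrow> j\<close> leaving the smallest remaining vertex: what remains is the same
  problem for \<open>q\<close> moved by \<open>- x\<close> along the root \<open>\<alpha>\<^sub>i + \<dots> + \<alpha>\<^sub>j\<^sub>-\<^sub>1\<close>, and \<open>x\<close> runs exactly over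
  \<open>[0, h\<^sub>i]\<close> because no edge enters \<open>i\<close> any more. So adding an edge to the graph replaces the volume
  polynomial \<open>F\<close> by \<open>F' = \<integral> F (q - x \<beta>) dx\<close>, that is, by the solution of the Cauchy problem
  \<open>(\<partial>\<^sub>i + \<dots> + \<partial>\<^sub>j\<^sub>-\<^sub>1) F' = F\<close>, \<open>F' = 0\<close> on \<open>q\<^sub>i = 0\<close>. One edge \<open>i \<rightarrow> l + 1\<close> per vertex is not integrated
  over, since conservation at \<open>i\<close> determines its value; it contributes the passage from the polynomial
  \<open>G\<close> of the vertices after \<open>i\<close> to its extension with \<open>(\<partial>\<^sub>i + \<dots> + \<partial>\<^sub>l) F = 0\<close>, \<open>F = G\<close> on \<open>q\<^sub>i = 0\<close>.

  The annihilator is computed along the same recursion. Let \<open>F\<close> be the polynomial obtained from \<open>G\<close>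
  after all \<open>N + 1\<close> edges out of \<open>i\<close>. The product \<open>P\<close> of the corresponding \<open>N + 1\<close> root operators kills
  \<open>F\<close>. It is monic in \<open>\<partial>\<^sub>i\<close>, so an operator that kills \<open>F\<close> can be reduced modulo \<open>P\<close> to
  \<open>\<Sum>\<^sub>k\<^sub>\<le>\<^sub>N \<partial>\<^sub>i\<^sup>k d\<^sub>k\<close>, with \<open>d\<^sub>k\<close> in the later \<open>\<partial>\<close>'s. By the boundary conditions, \<open>F\<close> vanishes to order
  exactly \<open>N\<close> on \<open>q\<^sub>i = 0\<close> with leading coefficient \<open>G\<close>: on \<open>q\<^sub>i = 0\<close> one has \<open>\<partial>\<^sub>i\<^sup>k F = 0\<close> for \<open>k < N\<close> and
  \<open>\<partial>\<^sub>i\<^sup>N F = G\<close>. Applying \<open>\<partial>\<^sub>i\<^sup>N\<^sup>-\<^sup>k\<close> and restricting to \<open>q\<^sub>i = 0\<close> therefore isolates \<open>d\<^sub>k G = 0\<close>, for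
  \<open>k = N, N - 1, \<dots>, 0\<close> in turn (lemma \<open>annihilator_descent\<close>), and induction on the vertices shows that
  every \<open>d\<^sub>k\<close> lies in the ideal of the later generators. Conversely the later generators, which kill
  \<open>G\<close>, kill \<open>F\<close> by uniqueness in the Cauchy problem. Lemma \<open>volume_polynomial\<close> carries both halves,
  the volume and the annihilator, through one induction.

  The volume in the hypothesis is normalized by the lattice of integral circulations. The cycles that
  use one edge and return through the sink form a lattice basis; in the resulting coordinates the
  polytope becomes the region of lemma \<open>polytope_coordinates\<close>. Finally a polynomial that vanishes on the
  nice chamber is zero, so the given \<open>v\<close> is the polynomial constructed above.
\<close>

section \<open>Coefficients of polynomials and constant coefficient operators\<close>

abbreviation lk where "lk \<equiv> Poly_Mapping.lookup"
abbreviation supp where "supp \<equiv> Poly_Mapping.keys"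
abbreviation expo :: "nat \<Rightarrow> nat \<Rightarrow> nat \<Rightarrow>\<^sub>0 nat" where "expo \<equiv> Poly_Mapping.single"

definition mfact :: "(nat \<Rightarrow>\<^sub>0 nat) \<Rightarrow> real" where
  "mfact a = (\<Prod>i\<in>supp a. fact (lk a i))"

lemma mfact_superset:
  assumes "finite S" "supp a \<subseteq> S"
  shows "mfact a = (\<Prod>i\<in>S. fact (lk a i))"
  unfolding mfact_def using assms
  by (intro prod.mono_neutral_left) (auto simp: in_keys_iff)

lemma mfact_pos: "mfact a > 0"
  unfolding mfact_def by (intro prod_pos) auto

lemma lookup_mderiv: "lk (mderiv i p) b = real (lk b i + 1) * lk p (b + expo i 1)"
proof -
  have "lk (mderiv i p) b =
      (\<Sum>a\<in>supp p. (of_nat (lk a i) * lk p a) when (a - expo i 1 = b))"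
    unfolding mderiv_def lookup_sum lookup_single by simp
  also have "\<dots> = (\<Sum>a\<in>supp p. if a = b + expo i 1 then real (lk b i + 1) * lk p a else 0)"
  proof (intro sum.cong refl)
    fix a
    show "(of_nat (lk a i) * lk p a when (a - expo i 1 = b)) =
        (if a = b + expo i 1 then real (lk b i + 1) * lk p a else 0)"
    proof (cases "a = b + expo i 1")
      case True
      then show ?thesis by (simp add: lookup_add)
    next
      case False
      have "lk a i = 0" if "a - expo i 1 = b"
      proof (rule ccontr)
        assume "lk a i \<noteq> 0"
        then have "a = b + expo i 1"
          using that by (auto intro!: poly_mapping_eqI simp: lookup_add lookup_minus lookup_single when_def)
        with False show False ..
      qed
      with False show ?thesis by (auto simp: when_def)
    qed
  qed
  also have "\<dots> = real (lk b i + 1) * lk p (b + expo i 1)"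
    by (simp add: in_keys_iff)
  finally show ?thesis .
qed

lemma lookup_mderiv_funpow:
  "lk ((mderiv i ^^ n) p) b = fact (lk b i + n) / fact (lk b i) * lk p (b + expo i n)"
proof (induction n arbitrary: b)
  case 0
  then show ?case by simp
next
  case (Suc n)
  have e: "b + expo i 1 + expo i n = b + expo i (Suc n)"
    by (simp add: single_add[symmetric] add.assoc)
  have "lk ((mderiv i ^^ Suc n) p) b = real (lk b i + 1) * lk ((mderiv i ^^ n) p) (b + expo i 1)"
    by (simp only: funpow.simps comp_apply lookup_mderiv)
  also have "\<dots> = real (lk b i + 1) * (fact (lk b i + 1 + n) / fact (lk b i + 1)) * lk p (b + expo i (Suc n))"
    by (simp only: Suc e lookup_add lookup_single_eq mult.assoc)
  also have "real (lk b i + 1) * (fact (lk b i + 1 + n) / fact (lk b i + 1)) =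
      fact (lk b i + Suc n) / fact (lk b i)"
    by (simp del: of_nat_Suc fact_Suc add: fact_Suc[of "lk b i"])
  finally show ?case .
qed

lemma lookup_fold_mderiv:
  assumes "distinct xs"
  shows "lk (fold (\<lambda>i. mderiv i ^^ f i) xs p) b =
    (\<Prod>i\<in>set xs. fact (lk b i + f i) / fact (lk b i)) * lk p (b + (\<Sum>i\<in>set xs. expo i (f i)))"
  using assms
proof (induction xs arbitrary: p b)
  case Nil
  then show ?case by simp
next
  case (Cons x xs)
  have "lk (b + (\<Sum>i\<in>set xs. expo i (f i))) x = lk b x"
    using Cons.prems by (auto simp: lookup_add lookup_sum lookup_single when_def intro!: sum.neutral)
  then show ?case
    using Cons by (simp add: lookup_mderiv_funpow add_ac)
qed

lemma sum_single_lookup: "(\<Sum>i\<in>supp a. expo i (lk a i)) = a"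
  by (intro poly_mapping_eqI)
    (auto simp: lookup_sum lookup_single when_def in_keys_iff)

lemma lookup_monom_op: "lk (monom_op a p) b = mfact (a + b) / mfact b * lk p (a + b)"
proof -
  have "lk (monom_op a p) b =
      (\<Prod>i\<in>supp a. fact (lk b i + lk a i) / fact (lk b i)) * lk p (a + b)"
    unfolding monom_op_def
    by (subst lookup_fold_mderiv) (simp_all add: sum_single_lookup add.commute)
  also have "(\<Prod>i\<in>supp a. fact (lk b i + lk a i) / fact (lk b i) :: real) =
      (\<Prod>i\<in>supp a \<union> supp b. fact (lk b i + lk a i) / fact (lk b i))"
    by (intro prod.mono_neutral_left) (auto simp: in_keys_iff)
  also have "\<dots> = mfact (a + b) / mfact b"
    by (subst (1 2) mfact_superset[of "supp a \<union> supp b"])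
      (auto simp: prod_dividef lookup_add add.commute in_keys_iff)
  finally show ?thesis .
qed

lemma lookup_mconst_mult: "lk (mconst c * p) b = c * lk p b"
  unfolding mconst_def mult_map_scale_conv_mult[symmetric]
  by (simp add: Poly_Mapping.map.rep_eq when_def)

text \<open>The coefficients with respect to the divided powers \<open>q\<^sup>b / b!\<close>. In this basis the operator
  \<open>\<partial>\<^sup>a\<close> is a shift of exponents, which makes composition of operators transparent.\<close>

definition dcoeff :: "mpolynomial \<Rightarrow> (nat \<Rightarrow>\<^sub>0 nat) \<Rightarrow> real" where
  "dcoeff p b = mfact b * lk p b"

lemma dcoeff_eqI: "(\<And>b. dcoeff p b = dcoeff q b) \<Longrightarrow> p = q"
  using mfact_pos by (auto intro!: poly_mapping_eqI simp: dcoeff_def) (metis less_irrefl)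

lemma dcoeff_add: "dcoeff (p + q) b = dcoeff p b + dcoeff q b"
  by (simp add: dcoeff_def lookup_add algebra_simps)

lemma dcoeff_diffop: "dcoeff (diffop D p) b = (\<Sum>a\<in>supp D. lk D a * dcoeff p (a + b))"
  unfolding dcoeff_def diffop_def lookup_sum lookup_mconst_mult lookup_monom_op sum_distrib_left
  using mfact_pos[of b] by (intro sum.cong) auto

lemma diffop_add_left: "diffop (D + E) p = diffop D p + diffop E p"
  by (rule dcoeff_eqI, unfold dcoeff_add dcoeff_diffop, rule setsum_keys_plus_distrib)
    (simp_all add: algebra_simps)

lemma diffop_add_right: "diffop D (p + q) = diffop D p + diffop D q"
  by (rule dcoeff_eqI) (simp add: dcoeff_add dcoeff_diffop algebra_simps sum.distrib)

lemma diffop_0_left [simp]: "diffop 0 p = 0"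
  by (simp add: diffop_def)

lemma diffop_0_right [simp]: "diffop D 0 = 0"
  by (metis add_cancel_right_right diffop_add_right)

lemma diffop_sum_left: "diffop (sum f A) p = (\<Sum>x\<in>A. diffop (f x) p)"
  by (induction A rule: infinite_finite_induct) (auto simp: diffop_add_left)

lemma diffop_sum_right: "diffop D (sum f A) = (\<Sum>x\<in>A. diffop D (f x))"
  by (induction A rule: infinite_finite_induct) (auto simp: diffop_add_right)

lemma diffop_uminus_left: "diffop (- D) p = - diffop D p"
  by (metis add.right_inverse add_eq_0_iff diffop_0_left diffop_add_left)

lemma diffop_diff_left: "diffop (D - E) p = diffop D p - diffop E p"
  by (metis diff_conv_add_uminus diffop_add_left diffop_uminus_left)

lemma diffop_uminus_right: "diffop D (- p) = - diffop D p"
  by (metis add.right_inverse add_eq_0_iff diffop_0_right diffop_add_right)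

lemma diffop_diff_right: "diffop D (p - q) = diffop D p - diffop D q"
  by (metis diff_conv_add_uminus diffop_add_right diffop_uminus_right)

lemma sum_singles: "(\<Sum>a\<in>supp p. Poly_Mapping.single a (lk p a)) = p"
  by (intro poly_mapping_eqI)
    (auto simp: lookup_sum lookup_single when_def in_keys_iff)

lemma dcoeff_diffop_single: "dcoeff (diffop (Poly_Mapping.single a c) p) b = c * dcoeff p (a + b)"
  by (simp add: dcoeff_diffop)

text \<open>Polynomials are a module over the ring of operators: both sides are biadditive in \<open>D\<close> and \<open>E\<close>,
  and for monomials the statement is that shifts of exponents add up.\<close>

lemma diffop_mult: "diffop (D * E) p = diffop D (diffop E p)"
proof -
  have s: "diffop (Poly_Mapping.single a c * Poly_Mapping.single b d) p =
      diffop (Poly_Mapping.single a c) (diffop (Poly_Mapping.single b d) p)" for a b c d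
    by (rule dcoeff_eqI) (simp add: mult_single dcoeff_diffop_single add_ac)
  have "diffop ((\<Sum>a\<in>supp D. Poly_Mapping.single a (lk D a)) *
      (\<Sum>a\<in>supp E. Poly_Mapping.single a (lk E a))) p =
    diffop (\<Sum>a\<in>supp D. Poly_Mapping.single a (lk D a))
      (diffop (\<Sum>a\<in>supp E. Poly_Mapping.single a (lk E a)) p)"
    unfolding sum_product diffop_sum_left s diffop_sum_right by (rule sum.swap)
  then show ?thesis by (simp add: sum_singles)
qed

lemma diffop_commute: "diffop D (diffop E p) = diffop E (diffop D p)"
  by (metis diffop_mult mult.commute)

lemma diffop_1 [simp]: "diffop 1 p = p"
  by (rule dcoeff_eqI) (use dcoeff_diffop_single[of 0 1 p] in simp)

lemma diffop_mvar: "diffop (mvar i) p = mderiv i p"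
  by (simp add: diffop_def mvar_def monom_op_def mconst_def)

section \<open>Polynomials in a given set of variables\<close>

definition Pol :: "nat set \<Rightarrow> mpolynomial set" where
  "Pol S = {p. mvars p \<subseteq> S}"

lemma Pol_iff: "p \<in> Pol S \<longleftrightarrow> (\<forall>a i. i \<notin> S \<longrightarrow> lk a i \<noteq> 0 \<longrightarrow> lk p a = 0)"
proof -
  have "p \<in> Pol S \<longleftrightarrow> (\<forall>a. lk p a \<noteq> 0 \<longrightarrow> (\<forall>i. lk a i \<noteq> 0 \<longrightarrow> i \<in> S))"
    unfolding Pol_def mvars_def mem_Collect_eq UN_subset_iff
    unfolding subset_eq Ball_def in_keys_iff by (rule refl)
  then show ?thesis by metis
qed

lemma Pol_add: "p \<in> Pol S \<Longrightarrow> q \<in> Pol S \<Longrightarrow> p + q \<in> Pol S"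
  by (auto simp: Pol_iff lookup_add)

lemma Pol_uminus: "p \<in> Pol S \<Longrightarrow> - p \<in> Pol S"
  by (auto simp: Pol_iff)

lemma Pol_diff: "p \<in> Pol S \<Longrightarrow> q \<in> Pol S \<Longrightarrow> p - q \<in> Pol S"
  by (auto simp: Pol_iff lookup_minus)

lemma Pol_0 [simp]: "0 \<in> Pol S"
  by (auto simp: Pol_iff)

lemma Pol_single: "(c \<noteq> 0 \<Longrightarrow> supp a \<subseteq> S) \<Longrightarrow> Poly_Mapping.single a c \<in> Pol S"
  by (auto simp: Pol_def mvars_def split: if_splits)

lemma Pol_1 [simp]: "1 \<in> Pol S"
  using Pol_single[of 1 0 S] by simp

lemma Pol_mvar: "i \<in> S \<Longrightarrow> mvar i \<in> Pol S"
  by (auto simp: mvar_def Pol_single)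

lemma Pol_sum: "(\<And>x. x \<in> A \<Longrightarrow> f x \<in> Pol S) \<Longrightarrow> sum f A \<in> Pol S"
  by (induction A rule: infinite_finite_induct) (auto simp: Pol_add)

lemma Pol_mult: assumes "p \<in> Pol S" "q \<in> Pol S" shows "p * q \<in> Pol S"
proof -
  have "supp c \<subseteq> S" if c0: "c \<in> supp (p * q)" for c
  proof -
    obtain a b where c: "c = a + b" and ab: "a \<in> supp p" "b \<in> supp q"
      using subsetD[OF keys_mult c0] by blast
    have "supp a \<subseteq> S" "supp b \<subseteq> S"
      using ab assms by (simp_all add: Pol_def mvars_def UN_subset_iff)
    moreover have "supp c \<subseteq> supp a \<union> supp b"
      unfolding c by (rule keys_add)
    ultimately show ?thesis by blast
  qed
  then show ?thesis by (auto simp: Pol_def mvars_def)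
qed

lemma Pol_prod: "(\<And>x. x \<in> A \<Longrightarrow> f x \<in> Pol S) \<Longrightarrow> prod f A \<in> Pol S"
  by (induction A rule: infinite_finite_induct) (auto simp: Pol_mult)

lemma Pol_power: "p \<in> Pol S \<Longrightarrow> p ^ n \<in> Pol S"
  by (induction n) (auto simp: Pol_mult)

lemma Pol_mono: "S \<subseteq> T \<Longrightarrow> p \<in> Pol S \<Longrightarrow> p \<in> Pol T"
  by (auto simp: Pol_def)

lemma Pol_diffop: assumes "p \<in> Pol S" shows "diffop D p \<in> Pol S"
proof -
  have "dcoeff (diffop D p) b = 0" if "i \<notin> S" "lk b i \<noteq> 0" for i b
    unfolding dcoeff_diffop
  proof (intro sum.neutral ballI)
    fix a
    have "lk (a + b) i \<noteq> 0" using that by (simp add: lookup_add)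
    then have "lk p (a + b) = 0" using assms that(1) by (simp add: Pol_iff)
    then show "lk D a * dcoeff p (a + b) = 0" by (simp add: dcoeff_def)
  qed
  then show ?thesis unfolding Pol_iff dcoeff_def using mfact_pos
    by (metis less_irrefl mult_eq_0_iff)
qed

lemma mvar_power: "mvar x ^ n = Poly_Mapping.single (expo x n) 1"
  by (induction n) (auto simp: mvar_def mult_single single_add[symmetric])

lemma lookup_mvar_0: "lk (mvar i) 0 = 0"
proof -
  have "expo i 1 \<noteq> 0" by (metis lookup_single_eq lookup_zero zero_neq_one)
  then show ?thesis by (simp add: mvar_def lookup_single when_def)
qed

lemma prod_mvar: "finite A \<Longrightarrow> (\<Prod>i\<in>A. mvar i ^ f i) = Poly_Mapping.single (\<Sum>i\<in>A. expo i (f i)) 1"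
proof (induction A rule: finite_induct)
  case (insert x F)
  then show ?case by (simp add: mvar_power mult_single)
qed simp

lemma Pol_induct [consumes 1, case_names const var add mult]:
  assumes "p \<in> Pol S" and c: "\<And>c. P (mconst c)" and v: "\<And>i. i \<in> S \<Longrightarrow> P (mvar i)"
    and add: "\<And>p q. P p \<Longrightarrow> P q \<Longrightarrow> P (p + q)" and mult: "\<And>p q. P p \<Longrightarrow> P q \<Longrightarrow> P (p * q)"
  shows "P p"
proof -
  have 1: "P 1" using c[of 1] by (simp add: mconst_def)
  have 0: "P 0" using c[of 0] by (simp add: mconst_def)
  have pw: "P (x ^ n)" if "P x" for x n using that by (induction n) (auto simp: 1 mult)
  have pr: "P (prod f A)" if "\<And>x. x \<in> A \<Longrightarrow> P (f x)" for f and A :: "nat set"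
    using that by (induction A rule: infinite_finite_induct) (auto simp: 1 mult)
  have sm: "P (sum f A)" if "\<And>x. x \<in> A \<Longrightarrow> P (f x)" for f and A :: "(nat \<Rightarrow>\<^sub>0 nat) set"
    using that by (induction A rule: infinite_finite_induct) (auto simp: 0 add)
  have "P (\<Sum>a\<in>supp p. Poly_Mapping.single a (lk p a))"
  proof (rule sm)
    fix a assume "a \<in> supp p"
    then have sub: "supp a \<subseteq> S" using assms(1) by (auto simp: Pol_def mvars_def)
    have "Poly_Mapping.single a (lk p a) = mconst (lk p a) * (\<Prod>i\<in>supp a. mvar i ^ lk a i)"
      by (simp add: prod_mvar sum_single_lookup mconst_def mult_single)
    also have "P \<dots>" using sub by (intro mult c pr pw v) auto
    finally show "P (Poly_Mapping.single a (lk p a))" .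
  qed
  then show ?thesis by (simp add: sum_singles)
qed

section \<open>The Cauchy problem for a first order operator\<close>

text \<open>Restriction to the hyperplane \<open>q\<^sub>i = 0\<close>, which carries the initial values.\<close>

definition set_zero :: "nat \<Rightarrow> mpolynomial \<Rightarrow> mpolynomial" where
  "set_zero i p = (\<Sum>a\<in>{a \<in> supp p. lk a i = 0}. Poly_Mapping.single a (lk p a))"

lemma lookup_set_zero: "lk (set_zero i p) b = (if lk b i = 0 then lk p b else 0)"
  unfolding set_zero_def by (auto simp: lookup_sum lookup_single when_def in_keys_iff)

lemma dcoeff_set_zero: "dcoeff (set_zero i p) b = (if lk b i = 0 then dcoeff p b else 0)"
  by (simp add: dcoeff_def lookup_set_zero)

lemma set_zero_0 [simp]: "set_zero i 0 = 0"
  by (intro poly_mapping_eqI) (simp add: lookup_set_zero)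

lemma set_zero_add: "set_zero i (p + q) = set_zero i p + set_zero i q"
  by (intro poly_mapping_eqI) (simp add: lookup_set_zero lookup_add)

lemma set_zero_uminus: "set_zero i (- p) = - set_zero i p"
  by (intro poly_mapping_eqI) (simp add: lookup_set_zero)

lemma set_zero_diff: "set_zero i (p - q) = set_zero i p - set_zero i q"
  by (intro poly_mapping_eqI) (simp add: lookup_set_zero lookup_minus)

lemma set_zero_sum: "set_zero i (sum f A) = (\<Sum>x\<in>A. set_zero i (f x))"
  by (induction A rule: infinite_finite_induct) (auto simp: set_zero_add)

lemma set_zero_Pol: "p \<in> Pol S \<Longrightarrow> i \<notin> S \<Longrightarrow> set_zero i p = p"
  by (intro poly_mapping_eqI) (auto simp: lookup_set_zero Pol_iff)

lemma set_zero_diffop: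
  assumes "D \<in> Pol S" "i \<notin> S"
  shows "set_zero i (diffop D p) = diffop D (set_zero i p)"
proof (rule dcoeff_eqI)
  fix b
  have "lk a i = 0" if "a \<in> supp D" for a
    using assms that by (auto simp: Pol_iff in_keys_iff)
  then show "dcoeff (set_zero i (diffop D p)) b = dcoeff (diffop D (set_zero i p)) b"
    by (auto simp: dcoeff_set_zero dcoeff_diffop lookup_add intro!: sum.cong)
qed

text \<open>The normal derivatives on \<open>q\<^sub>i = 0\<close> are the Taylor coefficients in \<open>q\<^sub>i\<close>: the divided power
  coefficient of \<open>p\<close> at \<open>b\<close> is one of \<open>\<partial>\<^sub>i\<^sup>k p\<close> with \<open>k = b\<^sub>i\<close> at an exponent without \<open>q\<^sub>i\<close>.\<close>

lemma eq_0_if_boundary_derivatives_0: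
  assumes "\<And>k. set_zero i (diffop (mvar i ^ k) p) = 0"
  shows "p = 0"
proof (rule dcoeff_eqI)
  fix b
  define c where "c = b - expo i (lk b i)"
  have c: "expo i (lk b i) + c = b" "lk c i = 0"
    by (auto intro!: poly_mapping_eqI simp: c_def lookup_add lookup_minus lookup_single when_def)
  have "dcoeff (set_zero i (diffop (mvar i ^ lk b i) p)) c = 0"
    using assms by (simp add: dcoeff_def)
  then show "dcoeff p b = dcoeff 0 b"
    using c by (simp add: dcoeff_set_zero mvar_power dcoeff_diffop_single) (simp add: dcoeff_def)
qed

text \<open>The equation turns a normal derivative \<open>\<partial>\<^sub>i\<close> into the tangential operator \<open>- M\<close>, which commutes with
  restriction to \<open>q\<^sub>i = 0\<close>. So all normal derivatives vanish on the hyperplane.\<close>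

lemma cauchy_unique:
  assumes "i \<notin> S" "M \<in> Pol S" "diffop (mvar i + M) F = 0" "set_zero i F = 0"
  shows "F = 0"
proof (rule eq_0_if_boundary_derivatives_0)
  fix k
  show "set_zero i (diffop (mvar i ^ k) F) = 0"
  proof (induction k)
    case 0
    then show ?case using assms by simp
  next
    case (Suc k)
    have "diffop (mvar i) F = - diffop M F"
      using assms(3) by (simp add: diffop_add_left eq_neg_iff_add_eq_0)
    then have "diffop (mvar i ^ Suc k) F = - diffop M (diffop (mvar i ^ k) F)"
      by (simp add: diffop_mult diffop_uminus_right diffop_commute[of "mvar i"] diffop_commute[of M])
    then show ?case
      using Suc assms by (simp add: set_zero_uminus set_zero_diffop)
  qed
qed

definition antideriv :: "nat \<Rightarrow> mpolynomial \<Rightarrow> mpolynomial" where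
  "antideriv i p = (\<Sum>a\<in>supp p. Poly_Mapping.single (a + expo i 1) (lk p a / real (lk a i + 1)))"

lemma lookup_antideriv:
  "lk (antideriv i p) b = (if lk b i = 0 then 0 else lk p (b - expo i 1) / real (lk b i))"
proof -
  have "lk (antideriv i p) b = (\<Sum>a\<in>supp p. (lk p a / real (lk a i + 1)) when a + expo i 1 = b)"
    unfolding antideriv_def lookup_sum lookup_single ..
  also have "\<dots> = (\<Sum>a\<in>supp p. if a = b - expo i 1 then
      (if lk b i = 0 then 0 else lk p a / real (lk b i)) else 0)"
  proof (intro sum.cong refl)
    fix a
    have "b - expo i 1 + expo i 1 = b" if "lk b i \<noteq> 0"
      using that by (auto intro!: poly_mapping_eqI simp: lookup_add lookup_minus lookup_single when_def)
    then show "((lk p a / real (lk a i + 1)) when a + expo i 1 = b) =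
      (if a = b - expo i 1 then (if lk b i = 0 then 0 else lk p a / real (lk b i)) else 0)"
      by (auto simp: when_def lookup_add)
  qed
  also have "\<dots> = (if lk b i = 0 then 0 else lk p (b - expo i 1) / real (lk b i))"
    by (simp add: in_keys_iff)
  finally show ?thesis .
qed

lemma diffop_antideriv: "diffop (mvar i) (antideriv i p) = p"
  unfolding diffop_mvar
  by (intro poly_mapping_eqI) (simp add: lookup_mderiv lookup_antideriv lookup_add)

lemma set_zero_antideriv: "set_zero i (antideriv i p) = 0"
  by (intro poly_mapping_eqI) (simp add: lookup_set_zero lookup_antideriv)

lemma Pol_antideriv: assumes "p \<in> Pol S" "i \<in> S" shows "antideriv i p \<in> Pol S"
  unfolding antideriv_def
proof (intro Pol_sum Pol_single)
  fix a assume "a \<in> supp p"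
  then have "supp a \<subseteq> S" using assms(1) by (auto simp: Pol_def mvars_def)
  then show "supp (a + expo i 1) \<subseteq> S"
    using assms(2) keys_add[of a "expo i 1"] by auto
qed

text \<open>Both sides have the same \<open>\<partial>\<^sub>i\<close> and vanish on \<open>q\<^sub>i = 0\<close>, so uniqueness in the Cauchy problem with
  \<open>M = 0\<close> applies.\<close>

lemma antideriv_diffop:
  assumes "i \<notin> S" "M \<in> Pol S"
  shows "diffop M (antideriv i p) = antideriv i (diffop M p)"
proof -
  have "diffop M (antideriv i p) - antideriv i (diffop M p) = 0"
  proof (rule cauchy_unique[of i S 0])
    show "diffop (mvar i + 0) (diffop M (antideriv i p) - antideriv i (diffop M p)) = 0"
      by (simp add: diffop_diff_right diffop_commute[of "mvar i"] diffop_antideriv)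
    show "set_zero i (diffop M (antideriv i p) - antideriv i (diffop M p)) = 0"
      using assms by (simp add: set_zero_diff set_zero_diffop set_zero_antideriv)
  qed (use assms in auto)
  then show ?thesis by simp
qed

lemma diffop_mvar_eq_0: "set_zero i p = p \<Longrightarrow> diffop (mvar i) p = 0"
proof (intro poly_mapping_eqI)
  fix b assume "set_zero i p = p"
  then have "lk p (b + expo i 1) = lk (set_zero i p) (b + expo i 1)" by simp
  also have "\<dots> = 0" unfolding lookup_set_zero by (simp add: lookup_add)
  finally show "lk (diffop (mvar i) p) b = lk 0 b"
    by (simp add: diffop_mvar lookup_mderiv)
qed

definition total_degree :: "(nat \<Rightarrow>\<^sub>0 nat) \<Rightarrow> nat" where
  "total_degree a = (\<Sum>i\<in>supp a. lk a i)"

lemma total_degree_add: "total_degree (a + b) = total_degree a + total_degree b"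
  unfolding total_degree_def by (rule setsum_keys_plus_distrib) simp_all

lemma total_degree_pos: "a \<noteq> 0 \<Longrightarrow> 0 < total_degree a"
proof -
  assume "a \<noteq> 0"
  then obtain i where "i \<in> supp a" by (metis keys_eq_empty ex_in_conv)
  then show ?thesis unfolding total_degree_def
    by (intro sum_pos2[of _ i]) (auto simp: in_keys_iff)
qed

text \<open>A strict bound on the total degree; the zero polynomial is the only one below \<open>0\<close>, which makes
  the bound a convenient induction parameter.\<close>

definition deg_less :: "nat \<Rightarrow> mpolynomial \<Rightarrow> bool" where
  "deg_less n p \<longleftrightarrow> (\<forall>a. n \<le> total_degree a \<longrightarrow> lk p a = 0)"

lemma deg_less_exists: "\<exists>n. deg_less n p"
proof (intro exI)
  show "deg_less (Suc (\<Sum>a\<in>supp p. total_degree a)) p"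
    unfolding deg_less_def
  proof (intro allI impI)
    fix a assume a: "Suc (\<Sum>a\<in>supp p. total_degree a) \<le> total_degree a"
    show "lk p a = 0"
    proof (rule ccontr)
      assume "lk p a \<noteq> 0"
      then have "total_degree a \<le> (\<Sum>a\<in>supp p. total_degree a)"
        by (intro member_le_sum) (auto simp: in_keys_iff)
      with a show False by simp
    qed
  qed
qed

lemma deg_less_0: "deg_less 0 p \<longleftrightarrow> p = 0"
  by (auto simp: deg_less_def intro!: poly_mapping_eqI)

lemma deg_less_mono: "deg_less n p \<Longrightarrow> n \<le> m \<Longrightarrow> deg_less m p"
  by (auto simp: deg_less_def)

lemma deg_less_diffop:
  assumes "lk D 0 = 0" "deg_less (Suc n) p"
  shows "deg_less n (diffop D p)"
  unfolding deg_less_def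
proof (intro allI impI)
  fix b assume b: "n \<le> total_degree b"
  have "dcoeff (diffop D p) b = 0"
    unfolding dcoeff_diffop
  proof (intro sum.neutral ballI)
    fix a assume "a \<in> supp D"
    then have "a \<noteq> 0" using assms(1) by (auto simp: in_keys_iff)
    then have "Suc n \<le> total_degree (a + b)" using b total_degree_pos[of a] by (simp add: total_degree_add)
    then show "lk D a * dcoeff p (a + b) = 0"
      using assms(2) by (simp add: deg_less_def dcoeff_def)
  qed
  then show "lk (diffop D p) b = 0" using mfact_pos[of b] by (simp add: dcoeff_def)
qed

lemma diffop_nilpotent:
  assumes "lk D 0 = 0" "deg_less n p"
  shows "diffop (D ^ n) p = 0"
  using assms(2)
proof (induction n arbitrary: p)
  case 0
  then show ?case by (simp add: deg_less_0)
next
  case (Suc n)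
  then have "diffop (D ^ n) (diffop D p) = 0" using deg_less_diffop[OF assms(1)] by blast
  then show ?case by (simp add: diffop_mult diffop_commute[of D])
qed

text \<open>The first guess \<open>\<integral> A dq\<^sub>i + B\<close> has the right initial values and violates the equation by \<open>M\<close>
  applied to it. This error is annihilated by one power of \<open>M\<close> less, and the correction has initial
  value \<open>0\<close>, so iterating terminates when \<open>M\<close> is nilpotent on the data.\<close>

lemma cauchy_exists_aux:
  assumes "i \<notin> S" "M \<in> Pol S" "A \<in> Pol (insert i S)" "B \<in> Pol S"
    and "diffop (M ^ n) A = 0" "diffop (M ^ n) B = 0"
  shows "\<exists>F\<in>Pol (insert i S). diffop (mvar i + M) F = A \<and> set_zero i F = B"
  using assms(3-6)
proof (induction n arbitrary: A B)
  case 0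
  then show ?case by (intro bexI[of _ 0]) auto
next
  case (Suc n)
  \<comment> \<open>Minus the error that the first guess makes in the equation.\<close>
  define A' where "A' = - (diffop M (antideriv i A) + diffop M B)"
  have Bi: "B \<in> Pol (insert i S)" using Suc.prems by (blast intro: Pol_mono)
  have "\<exists>F\<in>Pol (insert i S). diffop (mvar i + M) F = A' \<and> set_zero i F = 0"
  proof (rule Suc.IH)
    show "A' \<in> Pol (insert i S)"
      using Suc.prems Bi unfolding A'_def
      by (intro Pol_uminus Pol_add Pol_diffop Pol_antideriv) auto
    have *: "diffop (M ^ n) (diffop M X) = diffop (M ^ Suc n) X" for X
      by (simp only: power_Suc2 diffop_mult)
    have "M ^ Suc n \<in> Pol S" using assms by (intro Pol_power)
    then show "diffop (M ^ n) A' = 0"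
      unfolding A'_def diffop_uminus_right diffop_add_right *
      using antideriv_diffop[OF assms(1), of "M ^ Suc n" A] Suc.prems
      by (simp add: antideriv_def)
  qed auto
  then obtain F where F: "F \<in> Pol (insert i S)" "diffop (mvar i + M) F = A'" "set_zero i F = 0"
    by blast
  have r: "set_zero i B = B" using Suc.prems assms(1) by (simp add: set_zero_Pol)
  show ?case
  proof (intro bexI conjI)
    show "diffop (mvar i + M) (antideriv i A + B + F) = A"
      using r by (simp add: diffop_add_right F(2))
        (simp add: diffop_add_left diffop_antideriv diffop_mvar_eq_0 A'_def)
    show "set_zero i (antideriv i A + B + F) = B"
      by (simp add: set_zero_add set_zero_antideriv F(3) r)
    show "antideriv i A + B + F \<in> Pol (insert i S)"
      using Suc.prems F Bi by (intro Pol_add Pol_antideriv) auto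
  qed
qed

text \<open>An operator without constant term lowers degrees, hence is nilpotent on each polynomial.\<close>

lemma cauchy_exists:
  assumes "i \<notin> S" "M \<in> Pol S" "lk M 0 = 0" "A \<in> Pol (insert i S)" "B \<in> Pol S"
  shows "\<exists>F\<in>Pol (insert i S). diffop (mvar i + M) F = A \<and> set_zero i F = B"
proof -
  obtain n m where "deg_less n A" "deg_less m B" using deg_less_exists by meson
  then have "deg_less (max n m) A" "deg_less (max n m) B" by (auto elim: deg_less_mono)
  then show ?thesis
    using assms by (intro cauchy_exists_aux[where n = "max n m"] diffop_nilpotent)
qed

section \<open>Division by products of linear forms\<close>

text \<open>Modulo \<open>\<partial>\<^sub>i + M\<close> every variable, hence every polynomial, is congruent to one without \<open>\<partial>\<^sub>i\<close>.\<close>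

lemma linear_division:
  assumes "i \<notin> S" "M \<in> Pol S" "D \<in> Pol (insert i S)"
  shows "\<exists>Q\<in>Pol (insert i S). \<exists>d\<in>Pol S. D = Q * (mvar i + M) + d"
proof -
  have LI: "x \<in> Pol S \<Longrightarrow> x \<in> Pol (insert i S)" for x by (rule Pol_mono) auto
  have L: "mvar i + M \<in> Pol (insert i S)"
    using assms LI by (intro Pol_add Pol_mvar) auto
  from assms(3) show ?thesis
  proof (induction rule: Pol_induct)
    case (const c)
    show ?case
      by (intro bexI[of _ 0] bexI[of _ "mconst c"]) (auto simp: mconst_def intro!: Pol_single)
  next
    case (var k)
    show ?case
    proof (cases "k = i")
      case True
      then show ?thesis using assms(2)
        by (intro bexI[of _ 1] bexI[of _ "- M"]) (auto simp: Pol_uminus)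
    next
      case False
      then show ?thesis using var
        by (intro bexI[of _ 0] bexI[of _ "mvar k"]) (auto simp: Pol_mvar)
    qed
  next
    case (add p q)
    then obtain P d Q e where "P \<in> Pol (insert i S)" "d \<in> Pol S" "p = P * (mvar i + M) + d"
      "Q \<in> Pol (insert i S)" "e \<in> Pol S" "q = Q * (mvar i + M) + e" by blast
    then show ?case
      by (intro bexI[of _ "P + Q"] bexI[of _ "d + e"]) (auto simp: algebra_simps Pol_add)
  next
    case (mult p q)
    then obtain P d Q e where *: "P \<in> Pol (insert i S)" "d \<in> Pol S" "p = P * (mvar i + M) + d"
      "Q \<in> Pol (insert i S)" "e \<in> Pol S" "q = Q * (mvar i + M) + e" by blast
    have "p * q = (P * q + d * Q) * (mvar i + M) + d * e"
      unfolding *(3,6) by (simp add: algebra_simps)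
    moreover have "P * q + d * Q \<in> Pol (insert i S)"
      unfolding *(6) using Pol_add[OF Pol_mult[OF *(1) Pol_add[OF Pol_mult[OF *(4) L] LI[OF *(5)]]]
        Pol_mult[OF LI[OF *(2)] *(4)]] .
    ultimately show ?case using * Pol_mult by blast
  qed
qed

text \<open>Dividing the quotient by one linear factor after the other: a remainder
  \<open>\<Sum>\<^sub>k\<^sub><\<^sub>n \<partial>\<^sub>i\<^sup>k d\<^sub>k\<close> of the quotient, multiplied by the next factor \<open>\<partial>\<^sub>i + M\<close>, only gains one power of \<open>\<partial>\<^sub>i\<close>.\<close>

lemma monic_division:
  assumes "i \<notin> S" "\<And>M. M \<in> set Ms \<Longrightarrow> M \<in> Pol S" "D \<in> Pol (insert i S)"
  shows "\<exists>Q\<in>Pol (insert i S). \<exists>d. (\<forall>k. d k \<in> Pol S) \<and>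
    D = Q * (\<Prod>M\<leftarrow>Ms. mvar i + M) + (\<Sum>k<length Ms. mvar i ^ k * d k)"
  using assms(2,3)
proof (induction Ms arbitrary: D)
  case Nil
  then show ?case by (intro bexI[of _ D] exI[of _ "\<lambda>_. 0"]) auto
next
  case (Cons M Ms)
  let ?n = "length Ms" and ?P = "\<Prod>M\<leftarrow>Ms. mvar i + M"
  obtain Q e where Q: "Q \<in> Pol (insert i S)" "e \<in> Pol S" "D = Q * (mvar i + M) + e"
    using linear_division[OF assms(1), of M D] Cons.prems by auto
  obtain R d where R: "R \<in> Pol (insert i S)" "\<forall>k. d k \<in> Pol S"
    "Q = R * ?P + (\<Sum>k<?n. mvar i ^ k * d k)"
    using Cons.IH[of Q] Cons.prems Q by auto
  have alg: "(r * p + s) * x + y = r * (x * p) + (y + s * x)" for r p s x y :: mpolynomial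
    by (simp add: algebra_simps)
  \<comment> \<open>Coefficients of \<open>(\<Sum>\<^sub>k \<partial>\<^sub>i\<^sup>k d\<^sub>k) (\<partial>\<^sub>i + M) + e\<close>; at \<open>k = 0\<close> the sum multiplied by
    \<open>\<partial>\<^sub>i\<close> has no term and \<open>e\<close> takes its place.\<close>
  define d' where "d' k = (if k = 0 then e else d (k - 1)) + (if k < ?n then M * d k else 0)" for k
  have "(\<Sum>k<Suc ?n. mvar i ^ k * d' k) =
      (\<Sum>k<Suc ?n. mvar i ^ k * (if k = 0 then e else d (k - 1))) +
      (\<Sum>k<Suc ?n. if k < ?n then mvar i ^ k * (M * d k) else 0)"
    unfolding d'_def sum.distrib[symmetric] by (intro sum.cong refl) (simp add: distrib_left)
  also have "(\<Sum>k<Suc ?n. mvar i ^ k * (if k = 0 then e else d (k - 1))) =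
      e + (\<Sum>k<?n. mvar i ^ Suc k * d k)"
    by (subst sum.lessThan_Suc_shift) simp
  also have "(\<Sum>k<Suc ?n. if k < ?n then mvar i ^ k * (M * d k) else 0) =
      (\<Sum>k<?n. mvar i ^ k * (M * d k))" by simp
  also have "e + (\<Sum>k<?n. mvar i ^ Suc k * d k) + (\<Sum>k<?n. mvar i ^ k * (M * d k)) =
      e + (\<Sum>k<?n. mvar i ^ k * d k) * (mvar i + M)"
    unfolding sum_distrib_right add.assoc sum.distrib[symmetric]
    by (intro arg_cong2[where f = "(+)"] sum.cong refl) (simp add: algebra_simps)
  finally have "D = R * (\<Prod>M\<leftarrow>M # Ms. mvar i + M) + (\<Sum>k<length (M # Ms). mvar i ^ k * d' k)"
    using alg[of R ?P "\<Sum>k<?n. mvar i ^ k * d k" "mvar i + M" e]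
    unfolding Q(3) R(3) length_Cons list.map prod_list.Cons by simp
  moreover have "\<forall>k. d' k \<in> Pol S"
    unfolding d'_def using R(2) Q(2) Cons.prems(1) by (auto intro!: Pol_add Pol_mult)
  ultimately show ?case using R(1) by blast
qed

text \<open>The passage of annihilators from \<open>G\<close> to \<open>F\<close>. The hypotheses say that
  \<open>F = q\<^sub>i\<^sup>N / N! \<cdot> G + O(q\<^sub>i\<^sup>N\<^sup>+\<^sup>1)\<close>. If \<open>D\<close> kills \<open>F\<close>, so does its remainder \<open>\<Sum>\<^sub>k\<^sub>\<le>\<^sub>N \<partial>\<^sub>i\<^sup>k d\<^sub>k\<close>. Suppose that the
  \<open>d\<^sub>k\<^sub>'\<close> with \<open>k' > k\<close> are known to kill \<open>G\<close>; then they kill \<open>F\<close> and drop out. After \<open>\<partial>\<^sub>i\<^sup>N\<^sup>-\<^sup>k\<close> and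
  restriction to \<open>q\<^sub>i = 0\<close> the terms with \<open>k' < k\<close> disappear as well, since they carry fewer than \<open>N\<close>
  normal derivatives, and what is left is \<open>d\<^sub>k G = 0\<close>.\<close>

lemma annihilator_descent:
  assumes iS: "i \<notin> S" and Ms: "\<And>M. M \<in> set Ms \<Longrightarrow> M \<in> Pol S" "length Ms = Suc N"
    and low: "\<And>k. k < N \<Longrightarrow> set_zero i (diffop (mvar i ^ k) F) = 0"
    and top: "set_zero i (diffop (mvar i ^ N) F) = G"
    and kill: "\<And>d. d \<in> Pol S \<Longrightarrow> diffop d G = 0 \<Longrightarrow> diffop d F = 0"
    and P: "diffop (\<Prod>M\<leftarrow>Ms. mvar i + M) F = 0"
    and D: "D \<in> Pol (insert i S)" "diffop D F = 0"
  shows "\<exists>Q\<in>Pol (insert i S). \<exists>d. (\<forall>k. d k \<in> Pol S) \<and> (\<forall>k\<le>N. diffop (d k) G = 0) \<and>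
    D = Q * (\<Prod>M\<leftarrow>Ms. mvar i + M) + (\<Sum>k\<le>N. mvar i ^ k * d k)"
proof -
  obtain Q d where Q: "Q \<in> Pol (insert i S)" and d: "\<forall>k. d k \<in> Pol S" and
    eq: "D = Q * (\<Prod>M\<leftarrow>Ms. mvar i + M) + (\<Sum>k<Suc N. mvar i ^ k * d k)"
    using monic_division[of i S Ms D] iS Ms D(1) by auto
  have z: "(\<Sum>k<Suc N. diffop (mvar i ^ k * d k) F) = 0"
    using D(2) unfolding eq by (simp only: diffop_add_left diffop_mult P diffop_0_right diffop_sum_left add_0)
  \<comment> \<open>Downward induction on \<open>k = N - j\<close>, written as upward induction on \<open>j\<close>.\<close>
  have "diffop (d (N - j)) G = 0" if "j \<le> N" for j
    using that
  proof (induction j rule: less_induct)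
    case (less j)
    define k where "k = N - j"
    have kN: "k \<le> N" by (simp add: k_def)
    have hi: "diffop (d k') F = 0" if "k < k'" "k' \<le> N" for k'
      using less.IH[of "N - k'"] that less.prems kill d by (auto simp: k_def)
    have "0 = set_zero i (diffop (mvar i ^ (N - k)) (\<Sum>k'<Suc N. diffop (mvar i ^ k' * d k') F))"
      using z by simp
    also have "\<dots> = (\<Sum>k'<Suc N. diffop (d k') (set_zero i (diffop (mvar i ^ (N - k + k')) F)))"
      unfolding diffop_sum_right set_zero_sum
    proof (intro sum.cong refl)
      fix k'
      have "diffop (mvar i ^ (N - k)) (diffop (mvar i ^ k' * d k') F) =
          diffop (d k') (diffop (mvar i ^ (N - k + k')) F)"
        unfolding diffop_mult[symmetric] power_add by (simp add: ac_simps)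
      then show "set_zero i (diffop (mvar i ^ (N - k)) (diffop (mvar i ^ k' * d k') F)) =
          diffop (d k') (set_zero i (diffop (mvar i ^ (N - k + k')) F))"
        using set_zero_diffop[of "d k'" S i] d iS by simp
    qed
    also have "\<dots> = (\<Sum>k'<Suc N. if k' = k then diffop (d k) G else 0)"
    proof (intro sum.cong refl)
      fix k' assume "k' \<in> {..<Suc N}"
      then have k': "k' \<le> N" by simp
      consider "k' < k" | "k' = k" | "k < k'" by linarith
      then show "diffop (d k') (set_zero i (diffop (mvar i ^ (N - k + k')) F)) =
          (if k' = k then diffop (d k) G else 0)"
      proof cases
        case 1
        then show ?thesis using low[of "N - k + k'"] kN by simp
      next
        case 2
        then show ?thesis using top kN by simp
      next
        case 3
        have "diffop (d k') (set_zero i (diffop (mvar i ^ (N - k + k')) F)) =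
            set_zero i (diffop (mvar i ^ (N - k + k')) (diffop (d k') F))"
          using set_zero_diffop[of "d k'" S i "diffop (mvar i ^ (N - k + k')) F"] d iS
          by (simp add: diffop_commute[of "d k'" "mvar i ^ (N - k + k')"])
        with 3 hi k' show ?thesis by simp
      qed
    qed
    also have "\<dots> = diffop (d k) G" using kN by simp
    finally show ?case by (simp add: k_def)
  qed
  then have "diffop (d k) G = 0" if "k \<le> N" for k
    using that by (metis diff_diff_cancel diff_le_self)
  with Q d eq show ?thesis unfolding lessThan_Suc_atMost by blast
qed

section \<open>Evaluation and integration along a root\<close>

lemma meval_0 [simp]: "meval q 0 = 0"
  by (simp add: meval_def)

lemma meval_1 [simp]: "meval q 1 = 1"
  by (simp add: meval_def)

lemma meval_add: "meval q (p + r) = meval q p + meval q r"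
  unfolding meval_def by (rule setsum_keys_plus_distrib) (simp_all add: algebra_simps)

lemma meval_uminus: "meval q (- p) = - meval q p"
  using meval_add[of q p "- p"] by simp

lemma meval_diff: "meval q (p - r) = meval q p - meval q r"
  using meval_add[of q p "- r"] by (simp add: meval_uminus)

lemma meval_sum: "meval q (sum f A) = (\<Sum>x\<in>A. meval q (f x))"
  by (induction A rule: infinite_finite_induct) (auto simp: meval_add)

lemma meval_single:
  assumes "finite T" "supp a \<subseteq> T"
  shows "meval q (Poly_Mapping.single a c) = c * (\<Prod>i\<in>T. q i ^ lk a i)"
proof -
  have "(\<Prod>i\<in>supp a. q i ^ lk a i) = (\<Prod>i\<in>T. q i ^ lk a i)"
    using assms by (intro prod.mono_neutral_left) (auto simp: in_keys_iff)
  then show ?thesis by (simp add: meval_def)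
qed

lemma meval_cong:
  assumes "p \<in> Pol S" "\<And>i. i \<in> S \<Longrightarrow> q i = r i"
  shows "meval q p = meval r p"
  unfolding meval_def
proof (intro sum.cong refl arg_cong2[where f = "(*)"] prod.cong)
  fix a i assume "a \<in> supp p" "i \<in> supp a"
  then have "i \<in> S" using assms(1) by (auto simp: Pol_def mvars_def)
  then show "q i ^ lk a i = r i ^ lk a i" using assms(2) by simp
qed

lemma meval_set_zero:
  assumes "q i = 0"
  shows "meval q (set_zero i p) = meval q p"
proof -
  have "meval q (set_zero i p) = (\<Sum>a\<in>{a \<in> supp p. lk a i = 0}. lk p a * (\<Prod>k\<in>supp a. q k ^ lk a k))"
    unfolding set_zero_def meval_sum by (intro sum.cong refl) (simp add: meval_single[OF finite_keys order_refl])
  also have "\<dots> = meval q p"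
    unfolding meval_def
  proof (intro sum.mono_neutral_left ballI)
    fix a assume "a \<in> supp p - {a \<in> supp p. lk a i = 0}"
    then have "i \<in> supp a" by (auto simp: in_keys_iff)
    then have "(\<Prod>k\<in>supp a. q k ^ lk a k) = 0"
      using assms by (intro prod_zero) (auto simp: in_keys_iff intro!: bexI[of _ i])
    then show "lk p a * (\<Prod>k\<in>supp a. q k ^ lk a k) = 0" by simp
  qed auto
  finally show ?thesis .
qed

text \<open>Motion by \<open>t\<close> in the direction of the indicator vector of \<open>S\<close>. For \<open>S = {i..j - 1}\<close> this is the
  root \<open>e\<^sub>i - e\<^sub>j\<close> in the coordinates \<open>q\<close>.\<close>

definition slide :: "nat set \<Rightarrow> real \<Rightarrow> (nat \<Rightarrow> real) \<Rightarrow> nat \<Rightarrow> real" where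
  "slide S t q = (\<lambda>k. q k + (if k \<in> S then t else 0))"

lemma mderiv_single: "mderiv i (Poly_Mapping.single a c) =
    Poly_Mapping.single (a - expo i 1) (of_nat (lk a i) * c)"
  by (cases "c = 0") (auto simp: mderiv_def)

lemma meval_single_deriv:
  assumes S: "finite S"
  shows "((\<lambda>t. meval (slide S t q) (Poly_Mapping.single a c)) has_real_derivative
    meval (slide S t q) (\<Sum>i\<in>S. mderiv i (Poly_Mapping.single a c))) (at t)"
proof -
  define T where "T = supp a \<union> S"
  have T: "finite T" "supp a \<subseteq> T" "S \<subseteq> T" using S by (auto simp: T_def)
  let ?q = "slide S t q"
  have d: "((\<lambda>t. slide S t q i ^ lk a i) has_real_derivative
      (if i \<in> S then real (lk a i) * ?q i ^ (lk a i - 1) else 0)) (at t)" for i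
    unfolding slide_def by (auto intro!: derivative_eq_intros)
  have "((\<lambda>t. c * (\<Prod>i\<in>T. slide S t q i ^ lk a i)) has_real_derivative
     c * (\<Sum>i\<in>T. (if i \<in> S then real (lk a i) * ?q i ^ (lk a i - 1) else 0) *
       (\<Prod>k\<in>T - {i}. ?q k ^ lk a k))) (at t)"
    by (intro DERIV_cmult has_field_derivative_prod d)
  moreover have "c * (\<Sum>i\<in>T. (if i \<in> S then real (lk a i) * ?q i ^ (lk a i - 1) else 0) *
       (\<Prod>k\<in>T - {i}. ?q k ^ lk a k)) =
     (\<Sum>i\<in>S. c * (real (lk a i) * ?q i ^ (lk a i - 1) * (\<Prod>k\<in>T - {i}. ?q k ^ lk a k)))"
    unfolding sum_distrib_left using T by (intro sum.mono_neutral_cong_right) auto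
  also have "\<dots> = (\<Sum>i\<in>S. meval ?q (mderiv i (Poly_Mapping.single a c)))"
  proof (intro sum.cong refl)
    fix i assume "i \<in> S"
    then have i: "i \<in> T" using T by auto
    have "supp (a - expo i 1) \<subseteq> T"
      using T by (auto simp: in_keys_iff lookup_minus)
    then have "meval ?q (mderiv i (Poly_Mapping.single a c)) =
        real (lk a i) * c * (\<Prod>k\<in>T. ?q k ^ lk (a - expo i 1) k)"
      unfolding mderiv_single using T by (subst meval_single[of T]) auto
    also have "(\<Prod>k\<in>T. ?q k ^ lk (a - expo i 1) k) =
        ?q i ^ (lk a i - 1) * (\<Prod>k\<in>T - {i}. ?q k ^ lk a k)"
      using T i by (subst prod.remove[of T i])
        (auto simp: lookup_minus lookup_single when_def intro!: prod.cong)
    finally show "c * (real (lk a i) * ?q i ^ (lk a i - 1) * (\<Prod>k\<in>T - {i}. ?q k ^ lk a k)) =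
        meval ?q (mderiv i (Poly_Mapping.single a c))" by simp
  qed
  finally show ?thesis
    using T by (simp add: meval_single[of T] meval_sum)
qed

lemma meval_deriv:
  assumes S: "finite S"
  shows "((\<lambda>t. meval (slide S t q) p) has_real_derivative
    meval (slide S t q) (diffop (\<Sum>i\<in>S. mvar i) p)) (at t)"
proof -
  have "((\<lambda>t. \<Sum>a\<in>supp p. meval (slide S t q) (Poly_Mapping.single a (lk p a))) has_real_derivative
    (\<Sum>a\<in>supp p. meval (slide S t q) (\<Sum>i\<in>S. mderiv i (Poly_Mapping.single a (lk p a))))) (at t)"
    by (intro DERIV_sum meval_single_deriv S)
  moreover have "(\<Sum>a\<in>supp p. \<Sum>i\<in>S. mderiv i (Poly_Mapping.single a (lk p a))) =
      diffop (\<Sum>i\<in>S. mvar i) (\<Sum>a\<in>supp p. Poly_Mapping.single a (lk p a))"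
    unfolding diffop_sum_left diffop_sum_right diffop_mvar by (rule refl)
  ultimately show ?thesis
    unfolding meval_sum[symmetric] by (simp add: sum_singles)
qed

text \<open>A polynomial with vanishing directional derivative may be evaluated where the line through \<open>q\<close>
  meets the hyperplane \<open>q\<^sub>i = 0\<close>.\<close>

lemma meval_constant_along:
  assumes S: "finite S" "i \<in> S" and "diffop (\<Sum>i\<in>S. mvar i) F = 0"
  shows "meval q F = meval (slide S (- q i) q) (set_zero i F)"
proof -
  have "meval (slide S (- q i) q) F = meval (slide S 0 q) F"
    using meval_deriv[OF S(1), of q F] assms(3)
    by (intro DERIV_isconst_all) auto
  moreover have "slide S 0 q = q" by (auto simp: slide_def)
  moreover have "slide S (- q i) q i = 0" using S by (simp add: slide_def)
  ultimately show ?thesis by (simp add: meval_set_zero)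
qed

text \<open>The solution of the Cauchy problem with initial value \<open>0\<close> is the integral of the right hand side
  along the line from \<open>q\<close> to the hyperplane \<open>q\<^sub>i = 0\<close>.\<close>

lemma meval_integral:
  assumes S: "finite S" "i \<in> S" and F': "diffop (\<Sum>i\<in>S. mvar i) F' = F" "set_zero i F' = 0"
    and q: "0 \<le> q i" "\<And>x. 0 \<le> x \<Longrightarrow> x \<le> q i \<Longrightarrow> 0 \<le> meval (slide S (- x) q) F"
  shows "(\<integral>\<^sup>+x. ennreal (meval (slide S (- x) q) F) * indicator {0..q i} x \<partial>lborel) =
      ennreal (meval q F') \<and> 0 \<le> meval q F'"
proof -
  have s: "slide S (- q i) q i = 0" "slide S 0 q = q" using S by (auto simp: slide_def)
  then have z: "meval (slide S (- q i) q) F' = 0" using F'(2) by (metis meval_0 meval_set_zero)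
  have dm: "((\<lambda>x. meval (slide S (- x) q) p) has_real_derivative
      - meval (slide S (- x) q) (diffop (\<Sum>i\<in>S. mvar i) p)) (at x)" for p x
    using DERIV_chain2[where f = "\<lambda>t. meval (slide S t q) p" and g = uminus and x = x and Db = "-1"
        and s = UNIV, OF meval_deriv[OF S(1)]]
    by (simp add: DERIV_minus[OF DERIV_ident])
  have d: "((\<lambda>x. - meval (slide S (- x) q) F') has_real_derivative
      meval (slide S (- x) q) F) (at x)" for x
    using DERIV_minus[OF dm[of F' x]] by (simp add: F')
  have c: "(\<lambda>x. meval (slide S (- x) q) F) \<in> borel_measurable borel"
    by (rule borel_measurable_continuous_onI, rule DERIV_continuous_on, rule dm)
  have "(\<integral>\<^sup>+x. ennreal (meval (slide S (- x) q) F) * indicator {0..q i} x \<partial>lborel) =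
      ennreal (- meval (slide S (- q i) q) F' - - meval (slide S (- 0) q) F')"
    using c d q by (intro nn_integral_FTC_Icc) (auto intro: has_field_derivative_at_within)
  also have "\<dots> = ennreal (meval q F')" using z s by simp
  finally have 1: "(\<integral>\<^sup>+x. ennreal (meval (slide S (- x) q) F) * indicator {0..q i} x \<partial>lborel) =
      ennreal (meval q F')" .
  have "- meval (slide S (- 0) q) F' \<le> - meval (slide S (- q i) q) F'"
    using q d by (intro DERIV_nonneg_imp_nondecreasing[where f = "\<lambda>x. - meval (slide S (- x) q) F'"]) blast+
  then show ?thesis using 1 z s by simp
qed

section \<open>Polynomials vanishing on the nice chamber\<close>

lemma nice_slide:
  assumes "q \<in> nice_coords l" "1 \<le> i" "i \<le> l"
  shows "\<forall>\<^sub>F t in nhds 0. slide {i} t q \<in> nice_coords l"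
proof -
  have "\<forall>\<^sub>F t in nhds 0. 0 < slide {i} t q 1"
  proof (rule order_tendstoD)
    show "((\<lambda>t. slide {i} t q 1) \<longlongrightarrow> slide {i} 0 q 1) (nhds 0)"
      unfolding slide_def by (cases "i = 1") (auto intro!: tendsto_eq_intros filterlim_ident)
    show "0 < slide {i} 0 q 1" using assms(1) by (simp add: slide_def nice_coords_def)
  qed
  moreover have "\<forall>\<^sub>F t in nhds 0. \<forall>k\<in>{k. 1 \<le> k \<and> k < l}. slide {i} t q k < slide {i} t q (k + 1)"
  proof (intro eventually_ball_finite ballI)
    show "finite {k. 1 \<le> k \<and> k < l}" by (rule finite_subset[of _ "{..l}"]) auto
    fix k assume k: "k \<in> {k. 1 \<le> k \<and> k < l}"
    have "\<forall>\<^sub>F t in nhds 0. 0 < slide {i} t q (k + 1) - slide {i} t q k"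
    proof (rule order_tendstoD)
      show "((\<lambda>t. slide {i} t q (k + 1) - slide {i} t q k) \<longlongrightarrow> slide {i} 0 q (k + 1) - slide {i} 0 q k) (nhds 0)"
        unfolding slide_def
        by (cases "i = k + 1"; cases "i = k") (auto intro!: tendsto_eq_intros filterlim_ident)
      show "0 < slide {i} 0 q (k + 1) - slide {i} 0 q k"
        using assms(1) k by (auto simp: slide_def nice_coords_def)
    qed
    then show "\<forall>\<^sub>F t in nhds 0. slide {i} t q k < slide {i} t q (k + 1)" by simp
  qed
  ultimately show ?thesis
    by eventually_elim (auto simp: nice_coords_def)
qed

text \<open>The chamber is open along each coordinate direction, so all \<open>\<partial>\<^sub>i p\<close> vanish on it too and are zero by
  induction on the degree. Then \<open>p\<close> is constant, and its value at the point \<open>(1, \<dots>, l)\<close> is \<open>0\<close>.\<close>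

lemma zero_on_nice_coords:
  assumes "p \<in> Pol {1..l}" "\<And>q. q \<in> nice_coords l \<Longrightarrow> meval q p = 0"
  shows "p = 0"
proof -
  obtain n where "deg_less n p" using deg_less_exists by blast
  then show ?thesis using assms
  proof (induction n arbitrary: p)
    case 0
    then show ?case by (simp add: deg_less_0)
  next
    case (Suc n)
    have d0: "diffop (mvar i) p = 0" if i: "i \<in> {1..l}" for i
    proof (rule Suc.IH)
      show "deg_less n (diffop (mvar i) p)"
        using Suc.prems by (intro deg_less_diffop) (auto simp: lookup_mvar_0)
      show "diffop (mvar i) p \<in> Pol {1..l}" using Suc.prems by (intro Pol_diffop)
      fix q assume q: "q \<in> nice_coords l"
      have "\<forall>\<^sub>F t in nhds 0. 0 = meval (slide {i} t q) p"
        using nice_slide[OF q, of i] i by (auto elim!: eventually_mono simp: Suc.prems)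
      then have "((\<lambda>t. meval (slide {i} t q) p) has_real_derivative 0) (at 0)"
        using DERIV_cong_ev[of 0 0 "\<lambda>t. 0" "\<lambda>t. meval (slide {i} t q) p" 0 0] by simp
      then have "0 = meval (slide {i} 0 q) (diffop (\<Sum>k\<in>{i}. mvar k) p)"
        using meval_deriv[of "{i}" q p 0] by (intro DERIV_unique) auto
      then show "meval q (diffop (mvar i) p) = 0" by (simp add: slide_def)
    qed
    have c: "lk p a = 0" if "a \<noteq> 0" for a
    proof -
      obtain i where i: "lk a i \<noteq> 0" using \<open>a \<noteq> 0\<close> by (metis lookup_zero poly_mapping_eqI)
      show ?thesis
      proof (cases "i \<in> {1..l}")
        case True
        have "a - expo i 1 + expo i 1 = a"
          using i by (auto intro!: poly_mapping_eqI simp: lookup_add lookup_minus lookup_single when_def)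
        then have "lk (mderiv i p) (a - expo i 1) = real (lk (a - expo i 1) i + 1) * lk p a"
          by (simp only: lookup_mderiv)
        then show ?thesis using d0[OF True] by (simp add: diffop_mvar)
      next
        case False
        then show ?thesis using Suc.prems(2) i unfolding Pol_iff by blast
      qed
    qed
    have p: "p = Poly_Mapping.single 0 (lk p 0)"
      using c by (intro poly_mapping_eqI) (auto simp: lookup_single when_def)
    have "(\<lambda>k. real k) \<in> nice_coords l" by (auto simp: nice_coords_def)
    then have "meval real p = 0" using Suc.prems by blast
    then have "lk p 0 = 0" using meval_single[of "{}" 0 real "lk p 0"] p by auto
    with p show ?case by simp
  qed
qed

section \<open>Volumes of flow regions, one edge at a time\<close>

type_synonym edge = "nat \<times> nat \<times> nat"

abbreviation src :: "edge \<Rightarrow> nat" where "src e \<equiv> fst e"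
abbreviation tgt :: "edge \<Rightarrow> nat" where "tgt e \<equiv> fst (snd e)"

text \<open>Edges are listed, and a flow is a function of the position in the list, so that the domain of
  integration is a product over \<open>{..<n}\<close> and appending an edge adds one coordinate.\<close>

definition outflow :: "edge list \<Rightarrow> (nat \<Rightarrow> real) \<Rightarrow> nat \<Rightarrow> real" where
  "outflow es c t = (\<Sum>r<length es. if src (es ! r) = t then c r else 0)"

definition inflow :: "edge list \<Rightarrow> (nat \<Rightarrow> real) \<Rightarrow> nat \<Rightarrow> real" where
  "inflow es c t = (\<Sum>r<length es. if tgt (es ! r) = t then c r else 0)"

text \<open>Flows on the listed edges in which every vertex \<open>t \<le> l\<close> sends out at most what it has; the surplus
  is understood to go to the sink through an edge that is not listed.\<close>

definition region :: "nat \<Rightarrow> edge list \<Rightarrow> (nat \<Rightarrow> real) \<Rightarrow> (nat \<Rightarrow> real) set" where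
  "region l es h = {c \<in> {..<length es} \<rightarrow>\<^sub>E UNIV. (\<forall>r<length es. 0 \<le> c r) \<and>
     (\<forall>t\<in>{1..l}. outflow es c t \<le> h t + inflow es c t)}"

definition region_vol :: "nat \<Rightarrow> edge list \<Rightarrow> (nat \<Rightarrow> real) \<Rightarrow> ennreal" where
  "region_vol l es h = emeasure (\<Pi>\<^sub>M r\<in>{..<length es}. lborel) (region l es h)"

text \<open>The demand that remains when \<open>x\<close> units have been sent along \<open>e\<close>.\<close>

definition move_demand :: "edge \<Rightarrow> real \<Rightarrow> (nat \<Rightarrow> real) \<Rightarrow> nat \<Rightarrow> real" where
  "move_demand e x h = (\<lambda>t. h t - (if src e = t then x else 0) + (if tgt e = t then x else 0))"

lemma region_sets [measurable]: "region l es h \<in> sets (\<Pi>\<^sub>M r\<in>{..<length es}. lborel)"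
proof -
  have "region l es h = {c \<in> space (\<Pi>\<^sub>M r\<in>{..<length es}. lborel).
     (\<forall>r\<in>{..<length es}. 0 \<le> c r) \<and> (\<forall>t\<in>{1..l}. outflow es c t \<le> h t + inflow es c t)}"
    by (auto simp: region_def space_PiM)
  also have "\<dots> \<in> sets (\<Pi>\<^sub>M r\<in>{..<length es}. lborel)"
  proof -
    have Q: "(\<lambda>c. \<Sum>r<length es. if Q r then c r else 0) \<in>
        borel_measurable (\<Pi>\<^sub>M r\<in>{..<length es}. lborel :: real measure)" for Q :: "nat \<Rightarrow> bool"
    proof (rule borel_measurable_sum)
      fix r assume "r \<in> {..<length es}"
      then have "(\<lambda>c. c r) \<in> borel_measurable (\<Pi>\<^sub>M r\<in>{..<length es}. lborel :: real measure)"
        by measurable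
      then show "(\<lambda>c. if Q r then c r else 0) \<in>
          borel_measurable (\<Pi>\<^sub>M r\<in>{..<length es}. lborel :: real measure)"
        by (cases "Q r") auto
    qed
    have f: "(\<lambda>c. outflow es c t) \<in> borel_measurable (\<Pi>\<^sub>M r\<in>{..<length es}. lborel)"
      "(\<lambda>c. inflow es c t) \<in> borel_measurable (\<Pi>\<^sub>M r\<in>{..<length es}. lborel)" for t
      unfolding outflow_def inflow_def by (rule Q)+
    show ?thesis
    proof (intro sets.sets_Collect_conj sets.sets_Collect_finite_All)
      fix t
      show "{c \<in> space (\<Pi>\<^sub>M r\<in>{..<length es}. lborel). outflow es c t \<le> h t + inflow es c t}
          \<in> sets (\<Pi>\<^sub>M r\<in>{..<length es}. lborel)"
        by (intro borel_measurable_le borel_measurable_add f borel_measurable_const)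
    next
      fix r assume "r \<in> {..<length es}"
      then have "(\<lambda>c. c r) \<in> borel_measurable (\<Pi>\<^sub>M r\<in>{..<length es}. lborel :: real measure)"
        by measurable
      then show "{c \<in> space (\<Pi>\<^sub>M r\<in>{..<length es}. lborel). (0::real) \<le> c r}
          \<in> sets (\<Pi>\<^sub>M r\<in>{..<length es}. lborel)"
        by (rule borel_measurable_le[OF borel_measurable_const])
    qed auto
  qed
  finally show ?thesis .
qed

lemma region_vol_Nil: "(\<And>t. t \<in> {1..l} \<Longrightarrow> 0 \<le> h t) \<Longrightarrow> region_vol l [] h = 1"
proof -
  assume "\<And>t. t \<in> {1..l} \<Longrightarrow> 0 \<le> h t"
  then have "region l [] h = {\<lambda>_. undefined}"
    by (auto simp: region_def outflow_def inflow_def)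
  then show ?thesis unfolding region_vol_def by (simp add: lessThan_0)
qed

lemma outflow_snoc: "outflow (es @ [e]) (c(length es := x)) t =
    outflow es c t + (if src e = t then x else 0)"
  unfolding outflow_def by (auto simp: nth_append intro!: sum.cong)

lemma inflow_snoc: "inflow (es @ [e]) (c(length es := x)) t =
    inflow es c t + (if tgt e = t then x else 0)"
  unfolding inflow_def by (auto simp: nth_append intro!: sum.cong)

lemma region_snoc:
  assumes c: "c \<in> {..<length es} \<rightarrow>\<^sub>E UNIV"
  shows "c(length es := x) \<in> region l (es @ [e]) h \<longleftrightarrow> 0 \<le> x \<and> c \<in> region l es (move_demand e x h)"
proof -
  have "c(length es := x) \<in> {..<length (es @ [e])} \<rightarrow>\<^sub>E UNIV"
    using c by (auto simp: PiE_def extensional_def)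
  moreover have "(\<forall>r<length (es @ [e]). 0 \<le> (c(length es := x)) r) \<longleftrightarrow>
      0 \<le> x \<and> (\<forall>r<length es. 0 \<le> c r)"
    by (auto simp: less_Suc_eq)
  moreover have "outflow (es @ [e]) (c(length es := x)) t \<le> h t + inflow (es @ [e]) (c(length es := x)) t
      \<longleftrightarrow> outflow es c t \<le> move_demand e x h t + inflow es c t" for t
    unfolding outflow_snoc inflow_snoc move_demand_def by linarith
  ultimately show ?thesis using c by (auto simp: region_def)
qed

lemma region_vol_snoc:
  "region_vol l (es @ [e]) h = (\<integral>\<^sup>+x. indicator {0..} x * region_vol l es (move_demand e x h) \<partial>lborel)"
proof -
  let ?n = "length es"
  interpret product_sigma_finite "\<lambda>_. lborel" by standard
  have n: "{..<length (es @ [e])} = insert ?n {..<?n}" by auto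
  have "region l (es @ [e]) h \<in> sets (\<Pi>\<^sub>M r\<in>insert ?n {..<?n}. lborel)"
    using region_sets[of l "es @ [e]" h] unfolding n .
  note [measurable] = this
  have "region_vol l (es @ [e]) h = integral\<^sup>N (\<Pi>\<^sub>M r\<in>insert ?n {..<?n}. lborel) (indicator (region l (es @ [e]) h))"
    unfolding region_vol_def n by simp
  also have "\<dots> = (\<integral>\<^sup>+ y. (\<integral>\<^sup>+ c. indicator (region l (es @ [e]) h) (c(?n := y)) \<partial>(\<Pi>\<^sub>M r\<in>{..<?n}. lborel)) \<partial>lborel)"
    by (rule product_nn_integral_insert_rev) auto
  also have "\<dots> = (\<integral>\<^sup>+ y. (\<integral>\<^sup>+ c. indicator {0..} y * indicator (region l es (move_demand e y h)) c \<partial>(\<Pi>\<^sub>M r\<in>{..<?n}. lborel)) \<partial>lborel)"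
  proof (intro nn_integral_cong)
    fix y c assume "c \<in> space (\<Pi>\<^sub>M r\<in>{..<?n}. lborel :: real measure)"
    then have "c \<in> {..<?n} \<rightarrow>\<^sub>E UNIV" by (simp add: space_PiM)
    then show "indicator (region l (es @ [e]) h) (c(?n := y)) =
        (indicator {0..} y * indicator (region l es (move_demand e y h)) c :: ennreal)"
      by (auto simp: region_snoc split: split_indicator)
  qed
  also have "\<dots> = (\<integral>\<^sup>+ y. indicator {0..} y * region_vol l es (move_demand e y h) \<partial>lborel)"
    unfolding region_vol_def by (subst nn_integral_cmult) auto
  finally show ?thesis .
qed

text \<open>A vertex with negative demand and no incoming edge cannot be balanced. This is what bounds the
  integration over the last edge.\<close>

lemma region_vol_eq_0:
  assumes "t \<in> {1..l}" "h t < 0" "\<And>e. e \<in> set es \<Longrightarrow> tgt e \<noteq> t"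
  shows "region_vol l es h = 0"
proof -
  have "c \<notin> region l es h" for c
  proof
    assume c: "c \<in> region l es h"
    have "inflow es c t = 0"
      using assms(3) by (auto simp: inflow_def intro!: sum.neutral)
    moreover have "0 \<le> outflow es c t"
      using c by (auto simp: outflow_def region_def intro!: sum_nonneg)
    moreover have "outflow es c t \<le> h t + inflow es c t"
      using c assms(1) by (simp add: region_def)
    ultimately show False using assms(2) by linarith
  qed
  then have "region l es h = {}" by auto
  then show ?thesis by (simp add: region_vol_def)
qed

section \<open>The volume polynomial and its annihilator, vertex by vertex\<close>

definition root_op :: "nat \<Rightarrow> nat \<Rightarrow> mpolynomial" where
  "root_op i j = (\<Sum>r = i..j - 1. mvar r)"

definition vertex_op :: "nat \<Rightarrow> (nat \<Rightarrow> nat \<Rightarrow> nat) \<Rightarrow> nat \<Rightarrow> mpolynomial" where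
  "vertex_op l m i = (\<Prod>j = i + 1..l + 1. root_op i j ^ m i j)"

text \<open>The coordinates \<open>q\<close> belonging to a demand \<open>h\<close> on the vertices \<open>i, i + 1, \<dots>\<close> only.\<close>

definition partial_sum :: "nat \<Rightarrow> (nat \<Rightarrow> real) \<Rightarrow> nat \<Rightarrow> real" where
  "partial_sum i h = (\<lambda>k. \<Sum>t = i..k. h t)"

text \<open>The part of \<open>root_op i j\<close> that is tangential to the hyperplane \<open>q\<^sub>i = 0\<close>.\<close>

definition tail_op :: "nat \<Rightarrow> nat \<Rightarrow> mpolynomial" where
  "tail_op i j = (\<Sum>r = i + 1..j - 1. mvar r)"

lemma root_op_eq: "i < j \<Longrightarrow> root_op i j = mvar i + tail_op i j"
  unfolding root_op_def tail_op_def by (subst sum.atLeast_Suc_atMost) auto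

lemma Pol_tail_op: "j \<le> l + 1 \<Longrightarrow> tail_op i j \<in> Pol {i + 1..l}"
  unfolding tail_op_def by (intro Pol_sum Pol_mvar) auto

lemma Pol_root_op: "j \<le> l + 1 \<Longrightarrow> root_op i j \<in> Pol {i..l}"
  unfolding root_op_def by (intro Pol_sum Pol_mvar) auto

lemma Pol_vertex_op: "vertex_op l m i \<in> Pol {i..l}"
  unfolding vertex_op_def by (intro Pol_prod Pol_power Pol_root_op) auto

lemma lookup_tail_op_0: "lk (tail_op i j) 0 = 0"
  by (simp add: tail_op_def lookup_sum lookup_mvar_0)

lemma root_op_cauchy_unique:
  assumes "i < j" "j \<le> l + 1" "diffop (root_op i j) F = 0" "set_zero i F = 0"
  shows "F = 0"
proof (rule cauchy_unique[of i "{i + 1..l}" "tail_op i j"])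
  show "tail_op i j \<in> Pol {i + 1..l}" using assms by (intro Pol_tail_op)
qed (use assms in \<open>auto simp: root_op_eq\<close>)

lemma root_op_cauchy_exists:
  assumes "i < j" "j \<le> l + 1" "1 \<le> i" "i \<le> l" "A \<in> Pol {i..l}" "B \<in> Pol {i + 1..l}"
  shows "\<exists>F\<in>Pol {i..l}. diffop (root_op i j) F = A \<and> set_zero i F = B"
proof -
  have "insert i {i + 1..l} = {i..l}" using assms by auto
  then show ?thesis
    using cauchy_exists[of i "{i + 1..l}" "tail_op i j" A B] Pol_tail_op[of j l i] assms lookup_tail_op_0
    by (auto simp: root_op_eq)
qed

text \<open>Closed conditions \<open>0 \<le> h\<close> are used because the recursion over edges reaches the boundary of the
  chamber. Nonnegativity is recorded separately, as \<open>ennreal\<close> truncates negative numbers.\<close>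

definition represents :: "nat \<Rightarrow> nat \<Rightarrow> edge list \<Rightarrow> mpolynomial \<Rightarrow> bool" where
  "represents l i es F \<longleftrightarrow> (\<forall>h. (\<forall>t\<in>{1..l}. 0 \<le> h t) \<longrightarrow>
     0 \<le> meval (partial_sum i h) F \<and> region_vol l es h = ennreal (meval (partial_sum i h) F))"

text \<open>Passing from vertex \<open>i + 1\<close> to vertex \<open>i\<close> without listing an edge out of \<open>i\<close>: all of \<open>h\<^sub>i\<close> goes
  directly to the sink and has no influence on the volume. In the coordinates \<open>q\<close>, which are partial
  sums from \<open>i\<close> on, this independence says that the polynomial is invariant under translation along
  \<open>(1, \<dots>, 1)\<close>.\<close>

lemma represents_base:
  assumes i: "1 \<le> i" "i \<le> l" and G: "G \<in> Pol {i + 1..l}" "represents l (i + 1) es G"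
    and F: "diffop (root_op i (l + 1)) F = 0" "set_zero i F = G"
  shows "represents l i es F"
  unfolding represents_def
proof (intro allI impI)
  fix h :: "nat \<Rightarrow> real" assume h: "\<forall>t\<in>{1..l}. 0 \<le> h t"
  have "meval (partial_sum i h) F = meval (slide {i..l} (- partial_sum i h i) (partial_sum i h)) G"
    using meval_constant_along[of "{i..l}" i F] F i by (simp add: root_op_def)
  also have "\<dots> = meval (partial_sum (i + 1) h) G"
  proof (rule meval_cong[OF G(1)])
    fix k assume k: "k \<in> {i + 1..l}"
    then have "partial_sum i h k = h i + partial_sum (i + 1) h k"
      unfolding partial_sum_def by (subst sum.atLeast_Suc_atMost) auto
    with k show "slide {i..l} (- partial_sum i h i) (partial_sum i h) k = partial_sum (i + 1) h k"
      by (simp add: slide_def) (simp add: partial_sum_def)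
  qed
  finally show "0 \<le> meval (partial_sum i h) F \<and> region_vol l es h = ennreal (meval (partial_sum i h) F)"
    using G(2) h by (simp add: represents_def)
qed

lemma partial_sum_move_demand:
  assumes "src e = i" "i < tgt e" "i \<le> k"
  shows "partial_sum i (move_demand e x h) k = slide {i..tgt e - 1} (- x) (partial_sum i h) k"
proof -
  have "partial_sum i (move_demand e x h) k =
      partial_sum i h k - (\<Sum>t = i..k. if src e = t then x else 0) + (\<Sum>t = i..k. if tgt e = t then x else 0)"
    unfolding partial_sum_def move_demand_def by (simp only: sum.distrib sum_subtractf)
  then show ?thesis using assms by (auto simp: slide_def)
qed

text \<open>Appending an edge \<open>e\<close> from \<open>i\<close> to \<open>j\<close>, when no earlier edge enters \<open>i\<close>. For \<open>0 \<le> x \<le> h\<^sub>i\<close> the remaining demand is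
  again nonnegative and corresponds to \<open>q\<close> moved by \<open>- x\<close> along the root of \<open>e\<close>; for \<open>x > h\<^sub>i\<close> the
  region is empty. Note that \<open>h\<^sub>i\<close> equals \<open>q\<^sub>i\<close> here, so the line of integration ends on \<open>q\<^sub>i = 0\<close>.\<close>

lemma represents_step:
  assumes i: "1 \<le> i" "i \<le> l" and e: "src e = i" "i < tgt e" "tgt e \<le> l + 1"
    and es: "\<And>e. e \<in> set es \<Longrightarrow> i < tgt e"
    and F: "F \<in> Pol {i..l}" "represents l i es F"
    and F': "diffop (root_op i (tgt e)) F' = F" "set_zero i F' = 0"
  shows "represents l i (es @ [e]) F'"
  unfolding represents_def
proof (intro allI impI)
  fix h :: "nat \<Rightarrow> real" assume h: "\<forall>t\<in>{1..l}. 0 \<le> h t"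
  let ?S = "{i..tgt e - 1}" and ?q = "partial_sum i h"
  have qi: "?q i = h i" by (simp add: partial_sum_def)
  have in_range: "0 \<le> meval (slide ?S (- x) ?q) F \<and>
      region_vol l es (move_demand e x h) = ennreal (meval (slide ?S (- x) ?q) F)" if "0 \<le> x" "x \<le> h i" for x
  proof -
    have "\<forall>t\<in>{1..l}. 0 \<le> move_demand e x h t"
      using that h e by (auto simp: move_demand_def)
    moreover have "meval (partial_sum i (move_demand e x h)) F = meval (slide ?S (- x) ?q) F"
      using e by (intro meval_cong[OF F(1)] partial_sum_move_demand) auto
    ultimately show ?thesis using F(2) by (metis represents_def)
  qed
  have out: "region_vol l es (move_demand e x h) = 0" if "h i < x" for x
  proof (rule region_vol_eq_0)
    show "i \<in> {1..l}" using i by simp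
    show "move_demand e x h i < 0" using that e by (simp add: move_demand_def)
    show "\<And>e. e \<in> set es \<Longrightarrow> tgt e \<noteq> i" using es by force
  qed
  have "region_vol l (es @ [e]) h =
      (\<integral>\<^sup>+x. ennreal (meval (slide ?S (- x) ?q) F) * indicator {0..?q i} x \<partial>lborel)"
    unfolding region_vol_snoc qi using in_range out
    by (intro nn_integral_cong) (auto split: split_indicator simp: not_le)
  moreover have "(\<integral>\<^sup>+x. ennreal (meval (slide ?S (- x) ?q) F) * indicator {0..?q i} x \<partial>lborel) =
      ennreal (meval ?q F') \<and> 0 \<le> meval ?q F'"
  proof (rule meval_integral)
    show "diffop (\<Sum>r\<in>?S. mvar r) F' = F" using F'(1) by (simp add: root_op_def)
    show "0 \<le> ?q i" using h i qi by simp
    show "\<And>x. 0 \<le> x \<Longrightarrow> x \<le> ?q i \<Longrightarrow> 0 \<le> meval (slide ?S (- x) ?q) F"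
      using in_range qi by simp
    show "i \<in> ?S" using e by simp
  qed (use F' in simp_all)
  ultimately show "0 \<le> meval (partial_sum i h) F' \<and> region_vol l (es @ [e]) h = ennreal (meval (partial_sum i h) F')"
    by simp
qed

text \<open>All listed edges out of one vertex. Each one raises the order of vanishing on \<open>q\<^sub>i = 0\<close> by one and
  keeps the leading coefficient \<open>G\<close>: since \<open>\<partial>\<^sub>i = root_op - tail_op\<close>, the \<open>(k + 1)\<close>-st normal derivative of
  the new polynomial is the \<open>k\<close>-th one of the old polynomial as long as its own \<open>k\<close>-th one vanishes.\<close>

lemma vertex_stage:
  assumes i: "1 \<le> i" "i \<le> l" and es: "\<And>e. e \<in> set es \<Longrightarrow> i < tgt e"
    and G: "G \<in> Pol {i + 1..l}" "represents l (i + 1) es G"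
    and js: "\<And>e. e \<in> set js \<Longrightarrow> src e = i \<and> i < tgt e \<and> tgt e \<le> l + 1"
  shows "\<exists>F\<in>Pol {i..l}. represents l i (es @ js) F \<and>
    (\<forall>k<length js. set_zero i (diffop (mvar i ^ k) F) = 0) \<and>
    set_zero i (diffop (mvar i ^ length js) F) = G \<and>
    diffop (root_op i (l + 1) * (\<Prod>e\<leftarrow>js. root_op i (tgt e))) F = 0 \<and>
    (\<forall>D\<in>Pol {i + 1..l}. diffop D G = 0 \<longrightarrow> diffop D F = 0)"
  using js
proof (induction js rule: rev_induct)
  case Nil
  obtain F where F: "F \<in> Pol {i..l}" "diffop (root_op i (l + 1)) F = 0" "set_zero i F = G"
    using root_op_cauchy_exists[of i "l + 1" l 0 G] i G by auto
  have "diffop D F = 0" if "D \<in> Pol {i + 1..l}" "diffop D G = 0" for D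
  proof (rule root_op_cauchy_unique)
    show "i < l + 1" "l + 1 \<le> l + 1" using i by auto
    show "diffop (root_op i (l + 1)) (diffop D F) = 0"
      using F(2) by (simp add: diffop_commute[of _ D])
    show "set_zero i (diffop D F) = 0" using set_zero_diffop[OF that(1), of i F] that(2) F(3) by simp
  qed
  then show ?case using F represents_base[OF i G F(2,3)] by auto
next
  case (snoc e js)
  obtain F where F: "F \<in> Pol {i..l}" "represents l i (es @ js) F"
      "\<forall>k<length js. set_zero i (diffop (mvar i ^ k) F) = 0"
      "set_zero i (diffop (mvar i ^ length js) F) = G"
      "diffop (root_op i (l + 1) * (\<Prod>e\<leftarrow>js. root_op i (tgt e))) F = 0"
      "\<forall>D\<in>Pol {i + 1..l}. diffop D G = 0 \<longrightarrow> diffop D F = 0"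
    using snoc.IH snoc.prems by auto
  have e: "src e = i" "i < tgt e" "tgt e \<le> l + 1" using snoc.prems[of e] by auto
  obtain F' where F': "F' \<in> Pol {i..l}" "diffop (root_op i (tgt e)) F' = F" "set_zero i F' = 0"
    using root_op_cauchy_exists[of i "tgt e" l F 0] i e F(1) by auto
  have rep: "represents l i ((es @ js) @ [e]) F'"
  proof (rule represents_step[OF i e _ F(1,2) F'(2,3)])
    fix e' assume "e' \<in> set (es @ js)"
    then show "i < tgt e'" using es[of e'] snoc.prems[of e'] by auto
  qed
  have step: "set_zero i (diffop (mvar i ^ Suc k) F') =
      set_zero i (diffop (mvar i ^ k) F) - diffop (tail_op i (tgt e)) (set_zero i (diffop (mvar i ^ k) F'))" for k
  proof -
    have "diffop (mvar i ^ Suc k) F' = diffop (mvar i ^ k) (diffop (root_op i (tgt e) - tail_op i (tgt e)) F')"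
      using e by (simp add: diffop_mult[symmetric] root_op_eq mult.commute)
    also have "\<dots> = diffop (mvar i ^ k) F - diffop (tail_op i (tgt e)) (diffop (mvar i ^ k) F')"
      by (simp add: diffop_diff_left diffop_diff_right F' diffop_commute[of "mvar i ^ k" "tail_op i (tgt e)"])
    finally show ?thesis
      using set_zero_diffop[OF Pol_tail_op[OF e(3)], of i] by (simp add: set_zero_diff)
  qed
  have low: "set_zero i (diffop (mvar i ^ k) F') = 0" if "k \<le> length js" for k
    using that
  proof (induction k)
    case (Suc k)
    then show ?case using F(3) unfolding step by simp
  qed (simp add: F')
  have top: "set_zero i (diffop (mvar i ^ Suc (length js)) F') = G"
    unfolding step using low F(4) by simp
  have "diffop D F' = 0" if "D \<in> Pol {i + 1..l}" "diffop D G = 0" for D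
  proof (rule root_op_cauchy_unique[OF e(2,3)])
    show "diffop (root_op i (tgt e)) (diffop D F') = 0"
      using F'(2) F(6) that by (simp add: diffop_commute[of _ D])
    show "set_zero i (diffop D F') = 0" using set_zero_diffop[OF that(1), of i F'] F'(3) by simp
  qed
  moreover have "diffop (root_op i (l + 1) * (\<Prod>e\<leftarrow>js @ [e]. root_op i (tgt e))) F' = 0"
    using F(5) F'(2) by (simp add: mult.assoc[symmetric] diffop_mult)
  ultimately show ?case
    using F' rep low top by (intro bexI[of _ F']) (auto simp: less_Suc_eq_le)
qed

text \<open>The edges out of the vertices \<open>i, \<dots>, l\<close>, except the first edge of each of them into the sink.\<close>

definition inner_edges :: "nat \<Rightarrow> (nat \<Rightarrow> nat \<Rightarrow> nat) \<Rightarrow> nat \<Rightarrow> edge set" where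
  "inner_edges l m i = {(a, b, k). i \<le> a \<and> a < b \<and> b \<le> l + 1 \<and> 1 \<le> k \<and> k \<le> m a b \<and> (b, k) \<noteq> (l + 1, 1)}"

text \<open>The omitted edge into the sink supplies the factor \<open>root_op i (l + 1)\<close> of the generator.\<close>

lemma out_edges_prod:
  assumes i: "1 \<le> i" "i \<le> l" and m: "0 < m i (l + 1)"
    and js: "distinct js" "set js = {(a, b, k) \<in> inner_edges l m i. a = i}"
  shows "root_op i (l + 1) * (\<Prod>e\<leftarrow>js. root_op i (tgt e)) = vertex_op l m i"
proof -
  let ?A = "SIGMA j:{i + 1..l + 1}. {1..m i j}"
  have d: "distinct ((i, l + 1, 1) # js)" using js by (auto simp: inner_edges_def)
  have s: "set ((i, l + 1, 1) # js) = Pair i ` ?A"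
    unfolding list.set js using i m by (auto simp: inner_edges_def image_iff)
  have "root_op i (l + 1) * (\<Prod>e\<leftarrow>js. root_op i (tgt e)) =
      (\<Prod>e\<leftarrow>(i, l + 1, 1) # js. root_op i (tgt e))" by simp
  also have "\<dots> = (\<Prod>e\<in>Pair i ` ?A. root_op i (tgt e))"
    unfolding prod.distinct_set_conv_list[OF d, symmetric] s ..
  also have "\<dots> = (\<Prod>(j, k)\<in>?A. root_op i j)"
    by (subst prod.reindex) (auto simp: inj_on_def intro!: prod.cong)
  also have "\<dots> = (\<Prod>j = i + 1..l + 1. \<Prod>k = 1..m i j. root_op i j)"
    by (rule prod.Sigma[symmetric]) auto
  also have "\<dots> = vertex_op l m i" by (simp add: vertex_op_def)
  finally show ?thesis .
qed

lemma finite_inner_edges: "finite (inner_edges l m i)"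
proof (rule finite_subset)
  show "inner_edges l m i \<subseteq> (SIGMA a:{..l}. SIGMA b:{..l + 1}. {..m a b})"
    by (auto simp: inner_edges_def)
qed auto

text \<open>Downward induction on the vertex. The generators of the vertices after \<open>i\<close> kill \<open>G\<close>, hence \<open>F\<close>; an
  operator killing \<open>F\<close> is a multiple of the generator of \<open>i\<close> plus \<open>\<Sum> \<partial>\<^sub>i\<^sup>k d\<^sub>k\<close> with all \<open>d\<^sub>k\<close> killing \<open>G\<close>, and
  each \<open>d\<^sub>k\<close> is a combination of the later generators by the induction hypothesis.\<close>

lemma volume_polynomial:
  assumes m: "\<And>i j. 1 \<le> i \<Longrightarrow> i < j \<Longrightarrow> j \<le> l + 1 \<Longrightarrow> 0 < m i j"
    and "1 \<le> i" "i \<le> l + 1"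
  shows "\<exists>es F. distinct es \<and> set es = inner_edges l m i \<and> F \<in> Pol {i..l} \<and> represents l i es F \<and>
    (\<forall>k\<in>{i..l}. diffop (vertex_op l m k) F = 0) \<and>
    (\<forall>D\<in>Pol {i..l}. diffop D F = 0 \<longrightarrow>
      (\<exists>E. (\<forall>k. E k \<in> Pol {i..l}) \<and> D = (\<Sum>k = i..l. E k * vertex_op l m k)))"
  using assms(3,2)
proof (induction i rule: inc_induct)
  case base
  have "D = 0" if D: "D \<in> Pol {l + 1..l}" "diffop D 1 = 0" for D
  proof -
    have z: "lk D a = 0" if a: "a \<noteq> 0" for a
    proof -
      obtain i where "lk a i \<noteq> 0" using a by (metis lookup_zero poly_mapping_eqI)
      then show ?thesis using D(1) by (auto simp: Pol_iff)
    qed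
    then have e: "D = Poly_Mapping.single 0 (lk D 0)"
      by (intro poly_mapping_eqI) (auto simp: lookup_single when_def)
    have "lk D 0 * dcoeff 1 0 = dcoeff (diffop (Poly_Mapping.single 0 (lk D 0)) 1) 0"
      by (simp add: dcoeff_diffop_single)
    also have "\<dots> = 0" using D(2) e by (simp add: dcoeff_def)
    finally show "D = 0" using e mfact_pos[of 0] by (simp add: dcoeff_def)
  qed
  then have "\<exists>E. (\<forall>k. E k \<in> Pol {l + 1..l}) \<and> D = (\<Sum>k = l + 1..l. E k * vertex_op l m k)"
    if "D \<in> Pol {l + 1..l}" "diffop D 1 = 0" for D
    using that by (intro exI[of _ "\<lambda>_. 0"]) auto
  moreover have "inner_edges l m (l + 1) = {}" by (auto simp: inner_edges_def)
  moreover have "represents l (l + 1) [] 1"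
    unfolding represents_def using region_vol_Nil[of l] by simp
  ultimately show ?case by (intro exI[of _ "[]"] exI[of _ 1]) auto
next
  case (step i)
  then have i: "1 \<le> i" "i \<le> l" by auto
  obtain es G where es: "distinct es" "set es = inner_edges l m (i + 1)"
    and G: "G \<in> Pol {i + 1..l}" "represents l (i + 1) es G"
      "\<forall>k\<in>{i + 1..l}. diffop (vertex_op l m k) G = 0"
      "\<forall>D\<in>Pol {i + 1..l}. diffop D G = 0 \<longrightarrow>
        (\<exists>E. (\<forall>k. E k \<in> Pol {i + 1..l}) \<and> D = (\<Sum>k = i + 1..l. E k * vertex_op l m k))"
    using step.IH i by auto
  have "finite {(a, b, k) \<in> inner_edges l m i. a = i}"
    by (rule finite_subset[OF _ finite_inner_edges]) auto
  then obtain js where js: "set js = {(a, b, k) \<in> inner_edges l m i. a = i}" "distinct js"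
    using finite_distinct_list by blast
  obtain F where F: "F \<in> Pol {i..l}" "represents l i (es @ js) F"
      "\<forall>k<length js. set_zero i (diffop (mvar i ^ k) F) = 0"
      "set_zero i (diffop (mvar i ^ length js) F) = G"
      "diffop (root_op i (l + 1) * (\<Prod>e\<leftarrow>js. root_op i (tgt e))) F = 0"
      "\<forall>D\<in>Pol {i + 1..l}. diffop D G = 0 \<longrightarrow> diffop D F = 0"
    using vertex_stage[OF i _ G(1,2), of js] es(2) js(1) by (auto simp: inner_edges_def)
  have pr: "root_op i (l + 1) * (\<Prod>e\<leftarrow>js. root_op i (tgt e)) = vertex_op l m i"
    using i m[of i "l + 1"] js by (intro out_edges_prod) auto
  have ins: "insert i {i + 1..l} = {i..l}" using i by auto
  have up: "x \<in> Pol {i + 1..l} \<Longrightarrow> x \<in> Pol {i..l}" for x by (rule Pol_mono[of "{i + 1..l}"]) auto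
  have kills: "diffop (vertex_op l m k) F = 0" if "k \<in> {i..l}" for k
  proof (cases "k = i")
    case True
    then show ?thesis using F(5) pr by simp
  next
    case False
    then have k: "k \<in> {i + 1..l}" using that by auto
    then have "vertex_op l m k \<in> Pol {i + 1..l}"
      using Pol_vertex_op[of l m k] by (auto intro: Pol_mono[rotated])
    then show ?thesis using F(6) G(3) k by blast
  qed
  have "\<exists>E. (\<forall>k. E k \<in> Pol {i..l}) \<and> D = (\<Sum>k = i..l. E k * vertex_op l m k)"
    if D: "D \<in> Pol {i..l}" "diffop D F = 0" for D
  proof -
    \<comment> \<open>The omitted sink edge contributes the additional first factor, so there are \<open>N + 1\<close> factors for
      \<open>N\<close> listed edges.\<close>
    define Ms where "Ms = map (tail_op i) ((l + 1) # map tgt js)"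
    have Mprod: "(\<Prod>M\<leftarrow>Ms. mvar i + M) = vertex_op l m i"
    proof -
      have "(\<Prod>M\<leftarrow>Ms. mvar i + M) = root_op i (l + 1) * (\<Prod>e\<leftarrow>js. root_op i (tgt e))"
        unfolding Ms_def list.map prod_list.Cons map_map
      proof (intro arg_cong2[where f = "(*)"] arg_cong[where f = prod_list] map_cong refl)
        show "mvar i + tail_op i (l + 1) = root_op i (l + 1)" using i by (simp add: root_op_eq)
        fix e assume "e \<in> set js"
        then have "i < tgt e" using js(1) by (auto simp: inner_edges_def)
        then show "((+) (mvar i) \<circ> (tail_op i \<circ> tgt)) e = root_op i (tgt e)"
          by (simp add: root_op_eq)
      qed
      with pr show ?thesis by simp
    qed
    have Mpol: "M \<in> Pol {i + 1..l}" if "M \<in> set Ms" for M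
      using that js(1) by (auto simp: Ms_def inner_edges_def intro!: Pol_tail_op[simplified])
    have "\<exists>Q\<in>Pol (insert i {i + 1..l}). \<exists>d. (\<forall>k. d k \<in> Pol {i + 1..l}) \<and>
        (\<forall>k\<le>length js. diffop (d k) G = 0) \<and>
        D = Q * (\<Prod>M\<leftarrow>Ms. mvar i + M) + (\<Sum>k\<le>length js. mvar i ^ k * d k)"
    proof (rule annihilator_descent[where F = F])
      show "D \<in> Pol (insert i {i + 1..l})" unfolding ins by (rule D)
      show "diffop (\<Prod>M\<leftarrow>Ms. mvar i + M) F = 0" unfolding Mprod using kills i by simp
      show "length Ms = Suc (length js)" by (simp add: Ms_def)
    qed (use F D Mpol in auto)
    then obtain Q d where Q: "Q \<in> Pol {i..l}" and d: "\<forall>k. d k \<in> Pol {i + 1..l}"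
        "\<forall>k\<le>length js. diffop (d k) G = 0"
      and eq: "D = Q * vertex_op l m i + (\<Sum>k\<le>length js. mvar i ^ k * d k)"
      unfolding ins Mprod by blast
    have "\<forall>k. \<exists>E. k \<le> length js \<longrightarrow> (\<forall>t. E t \<in> Pol {i + 1..l}) \<and> d k = (\<Sum>t = i + 1..l. E t * vertex_op l m t)"
      using G(4) d by blast
    then obtain E where E: "k \<le> length js \<Longrightarrow> E k t \<in> Pol {i + 1..l}"
      "k \<le> length js \<Longrightarrow> d k = (\<Sum>t = i + 1..l. E k t * vertex_op l m t)" for k t
      by metis
    \<comment> \<open>Collect the coefficient of each generator in \<open>Q P + \<Sum>\<^sub>k \<partial>\<^sub>i\<^sup>k d\<^sub>k\<close>.\<close>
    define H where "H t = (if t = i then Q else \<Sum>k\<le>length js. mvar i ^ k * E k t)" for t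
    have "(\<Sum>k\<le>length js. mvar i ^ k * d k) = (\<Sum>k\<le>length js. \<Sum>t = i + 1..l. mvar i ^ k * E k t * vertex_op l m t)"
      by (intro sum.cong refl) (simp add: E sum_distrib_left mult.assoc)
    also have "\<dots> = (\<Sum>t = i + 1..l. H t * vertex_op l m t)"
      by (subst sum.swap) (simp add: H_def sum_distrib_right)
    finally have "D = (\<Sum>t = i..l. H t * vertex_op l m t)"
      unfolding eq ins[symmetric] by (simp add: H_def)
    moreover have "H t \<in> Pol {i..l}" for t
      using Q i up E by (auto simp: H_def intro!: Pol_sum Pol_mult Pol_power Pol_mvar)
    ultimately show ?thesis by blast
  qed
  moreover have "distinct (es @ js)" using es js by (auto simp: inner_edges_def)
  moreover have "set (es @ js) = inner_edges l m i"
    using es js by (auto simp: inner_edges_def)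
  ultimately show ?case
    using F(1,2) kills by (intro exI[of _ "es @ js"] exI[of _ F]) auto
qed

section \<open>Lattice coordinates on the space of flows\<close>

text \<open>The edges \<open>t \<rightarrow> l + 1\<close> with multiplicity index \<open>1\<close> form a spanning star. A flow is determined by its
  values on the other edges, integrally in both directions.\<close>

definition sink_edge :: "nat \<Rightarrow> nat \<Rightarrow> edge" where
  "sink_edge l t = (t, l + 1, 1)"

text \<open>The fundamental cycle of \<open>e\<close> with respect to the star: along \<open>e\<close> from \<open>i\<close> to \<open>j\<close>, then to the sink
  and backwards to \<open>i\<close>. If \<open>e\<close> already ends in the sink the middle piece is missing.\<close>

definition sink_cycle :: "nat \<Rightarrow> edge \<Rightarrow> flow" where
  "sink_cycle l e = (\<lambda>f. (if f = e then 1 else 0) - (if f = sink_edge l (src e) then 1 else 0)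
     + (if tgt e \<le> l \<and> f = sink_edge l (tgt e) then 1 else 0))"

definition sink_flow :: "nat \<Rightarrow> (nat \<Rightarrow> real) \<Rightarrow> flow" where
  "sink_flow l h = (\<lambda>f. if f \<in> sink_edge l ` {1..l} then h (src f) else 0)"

definition flow_of :: "nat \<Rightarrow> edge list \<Rightarrow> (nat \<Rightarrow> real) \<Rightarrow> (nat \<Rightarrow> real) \<Rightarrow> flow" where
  "flow_of l es h c = (\<lambda>f. sink_flow l h f + (\<Sum>r<length es. c r * sink_cycle l (es ! r) f))"

definition netflow :: "nat \<Rightarrow> (nat \<Rightarrow> nat \<Rightarrow> nat) \<Rightarrow> flow \<Rightarrow> nat \<Rightarrow> real" where
  "netflow l m x t = (\<Sum>f\<in>flow_index l m. x f * (unit_vec (src f) t - unit_vec (tgt f) t))"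

lemma flow_space_iff: "x \<in> flow_space l m h \<longleftrightarrow>
    (\<forall>f. f \<notin> flow_index l m \<longrightarrow> x f = 0) \<and> (\<forall>t. netflow l m x t = h t)"
  by (simp add: flow_space_def netflow_def case_prod_unfold)

lemma flow_index_eq:
  assumes "\<And>i. 1 \<le> i \<Longrightarrow> i \<le> l \<Longrightarrow> 0 < m i (l + 1)"
  shows "flow_index l m = inner_edges l m 1 \<union> sink_edge l ` {1..l}"
  using assms by (fastforce simp: flow_index_def inner_edges_def sink_edge_def image_iff)

lemma sink_edge_not_inner: "sink_edge l t \<notin> inner_edges l m i"
  by (simp add: sink_edge_def inner_edges_def)

lemma netflow_add: "netflow l m (\<lambda>f. x f + y f) t = netflow l m x t + netflow l m y t"
  by (simp add: netflow_def distrib_right sum.distrib)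

lemma netflow_diff: "netflow l m (\<lambda>f. x f - y f) t = netflow l m x t - netflow l m y t"
  by (simp add: netflow_def left_diff_distrib sum_subtractf)

lemma netflow_scale: "netflow l m (\<lambda>f. a * x f) t = a * netflow l m x t"
  by (simp add: netflow_def sum_distrib_left mult.assoc)

lemma netflow_sum: "netflow l m (\<lambda>f. \<Sum>r\<in>A. x r f) t = (\<Sum>r\<in>A. netflow l m (x r) t)"
  unfolding netflow_def sum_distrib_right by (rule sum.swap)

lemma finite_flow_index: "finite (flow_index l m)"
proof (rule finite_subset)
  show "flow_index l m \<subseteq> (SIGMA a:{..l}. SIGMA b:{..l + 1}. {..m a b})"
    by (auto simp: flow_index_def)
qed auto

lemma netflow_single:
  assumes "e \<in> flow_index l m"
  shows "netflow l m (\<lambda>f. if f = e then a else 0) t = a * (unit_vec (src e) t - unit_vec (tgt e) t)"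
  using assms finite_flow_index[of l m]
  by (simp add: netflow_def if_distrib[where f = "\<lambda>x. x * _"] cong: if_cong)

text \<open>An enumeration of the edges outside the star.\<close>

locale star_coordinates =
  fixes l :: nat and m :: "nat \<Rightarrow> nat \<Rightarrow> nat" and es :: "edge list"
  assumes pos: "\<And>i. 1 \<le> i \<Longrightarrow> i \<le> l \<Longrightarrow> 0 < m i (l + 1)"
    and dist: "distinct es" and set_es: "set es = inner_edges l m 1"
begin

lemma index_eq: "flow_index l m = inner_edges l m 1 \<union> sink_edge l ` {1..l}"
  using pos by (intro flow_index_eq) auto

lemma nth_inner: "r < length es \<Longrightarrow> es ! r \<in> inner_edges l m 1"
  using set_es nth_mem by blast

lemma sink_cycle_support:
  assumes e: "e \<in> inner_edges l m 1" and f: "f \<notin> flow_index l m"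
  shows "sink_cycle l e f = 0"
proof -
  have "1 \<le> src e" "src e < tgt e" "tgt e \<le> l + 1" using e by (auto simp: inner_edges_def)
  then have "f \<noteq> e" "f \<noteq> sink_edge l (src e)" "tgt e \<le> l \<Longrightarrow> f \<noteq> sink_edge l (tgt e)"
    using e f unfolding index_eq by auto
  then show ?thesis by (simp add: sink_cycle_def)
qed

lemma netflow_sink_cycle:
  assumes e: "e \<in> inner_edges l m 1"
  shows "netflow l m (sink_cycle l e) t = 0"
proof -
  have i: "e \<in> flow_index l m" "sink_edge l (src e) \<in> flow_index l m"
    using e unfolding index_eq by (auto simp: inner_edges_def)
  have b: "1 \<le> src e" "src e < tgt e" "tgt e \<le> l + 1" using e by (auto simp: inner_edges_def)
  have 3: "netflow l m (\<lambda>f. if tgt e \<le> l \<and> f = sink_edge l (tgt e) then 1 else 0) t =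
      unit_vec (tgt e) t - unit_vec (l + 1) t"
  proof (cases "tgt e \<le> l")
    case True
    then have "sink_edge l (tgt e) \<in> flow_index l m" using b unfolding index_eq by auto
    then show ?thesis using True by (simp add: netflow_single) (simp add: sink_edge_def)
  next
    case False
    then have "tgt e = l + 1" using b by simp
    then show ?thesis by (simp add: netflow_def)
  qed
  show ?thesis
    unfolding sink_cycle_def netflow_add netflow_diff 3 netflow_single[OF i(1)] netflow_single[OF i(2)]
    by (simp add: sink_edge_def)
qed

lemma netflow_sink_flow: "netflow l m (sink_flow l h) t = (\<Sum>s = 1..l. h s * (unit_vec s t - unit_vec (l + 1) t))"
proof -
  have "netflow l m (sink_flow l h) t =
      (\<Sum>f\<in>sink_edge l ` {1..l}. h (src f) * (unit_vec (src f) t - unit_vec (tgt f) t))"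
    unfolding netflow_def using finite_flow_index[of l m] index_eq
    by (intro sum.mono_neutral_cong_right) (auto simp: sink_flow_def)
  also have "\<dots> = (\<Sum>s = 1..l. h s * (unit_vec s t - unit_vec (l + 1) t))"
    by (subst sum.reindex) (auto simp: inj_on_def sink_edge_def)
  finally show ?thesis .
qed

lemma flow_of_inner:
  assumes "r < length es"
  shows "flow_of l es h c (es ! r) = c r"
proof -
  have n: "es ! r \<noteq> sink_edge l t" for t using nth_inner[OF assms] sink_edge_not_inner by metis
  have "sink_cycle l (es ! s) (es ! r) = (if s = r then 1 else 0)" if "s < length es" for s
    using that assms n dist by (auto simp: sink_cycle_def nth_eq_iff_index_eq)
  then have "(\<Sum>s<length es. c s * sink_cycle l (es ! s) (es ! r)) = (\<Sum>s<length es. if s = r then c s else 0)"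
    by (intro sum.cong) auto
  then show ?thesis using assms n by (auto simp: flow_of_def sink_flow_def)
qed

lemma flow_of_sink_edge:
  assumes "t \<in> {1..l}"
  shows "flow_of l es h c (sink_edge l t) = h t + inflow es c t - outflow es c t"
proof -
  have "c r * sink_cycle l (es ! r) (sink_edge l t) =
      (if tgt (es ! r) = t then c r else 0) - (if src (es ! r) = t then c r else 0)"
    if "r < length es" for r
  proof -
    have "sink_edge l t \<noteq> es ! r" using nth_inner[OF that] sink_edge_not_inner by metis
    moreover have "sink_edge l a = sink_edge l b \<longleftrightarrow> a = b" for a b by (simp add: sink_edge_def)
    ultimately show ?thesis using assms by (auto simp: sink_cycle_def)
  qed
  then have "(\<Sum>r<length es. c r * sink_cycle l (es ! r) (sink_edge l t)) = inflow es c t - outflow es c t"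
    by (simp add: inflow_def outflow_def sum_subtractf)
  then show ?thesis using assms by (simp add: flow_of_def sink_flow_def) (simp add: sink_edge_def)
qed

text \<open>The demands that the star alone can satisfy: \<open>h\<close> vanishes off \<open>{1..l + 1}\<close> and has total \<open>0\<close>.\<close>

definition balanced :: "(nat \<Rightarrow> real) \<Rightarrow> bool" where
  "balanced h \<longleftrightarrow> (\<forall>t. (\<Sum>s = 1..l. h s * (unit_vec s t - unit_vec (l + 1) t)) = h t)"

lemma flow_of_in_flow_space:
  assumes "balanced h"
  shows "flow_of l es h c \<in> flow_space l m h"
  unfolding flow_space_iff
proof (intro conjI allI impI)
  fix f assume f: "f \<notin> flow_index l m"
  then have "f \<notin> sink_edge l ` {1..l}" unfolding index_eq by blast
  then show "flow_of l es h c f = 0"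
    using f sink_cycle_support nth_inner by (simp add: flow_of_def sink_flow_def)
next
  fix t
  show "netflow l m (flow_of l es h c) t = h t"
    unfolding flow_of_def netflow_add netflow_sum netflow_scale netflow_sink_flow
    using assms nth_inner by (simp add: netflow_sink_cycle balanced_def)
qed

text \<open>The difference of the two sides is a circulation supported on the star. A vertex \<open>t \<le> l\<close> meets
  only one edge of the star, so conservation at \<open>t\<close> forces the value there to be \<open>0\<close>.\<close>

lemma flow_space_eq_flow_of:
  assumes "balanced h" "x \<in> flow_space l m h"
  shows "x = flow_of l es h (\<lambda>r. x (es ! r))"
proof -
  define y where "y f = x f - flow_of l es h (\<lambda>r. x (es ! r)) f" for f
  have w: "flow_of l es h (\<lambda>r. x (es ! r)) \<in> flow_space l m h"
    using assms by (intro flow_of_in_flow_space)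
  have net: "netflow l m y t = 0" for t
    using w assms(2) unfolding y_def netflow_diff flow_space_iff by simp
  have in0: "y f = 0" if f: "f \<in> inner_edges l m 1" for f
  proof -
    obtain r where "r < length es" "f = es ! r" using f set_es by (metis in_set_conv_nth)
    then show ?thesis using flow_of_inner by (simp add: y_def)
  qed
  have out0: "y f = 0" if f: "f \<notin> flow_index l m" for f
  proof -
    have "x f = 0" "flow_of l es h (\<lambda>r. x (es ! r)) f = 0"
      using w assms(2) f unfolding flow_space_iff by blast+
    then show ?thesis by (simp add: y_def)
  qed
  have "y (sink_edge l t) = 0" if t: "t \<in> {1..l}" for t
  proof -
    have "0 = (\<Sum>f\<in>sink_edge l ` {1..l}. y f * (unit_vec (src f) t - unit_vec (tgt f) t))"
      using net[of t, symmetric] unfolding netflow_def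
      using finite_flow_index[of l m] in0 index_eq
      by (subst (asm) sum.mono_neutral_right[of _ "sink_edge l ` {1..l}"]) auto
    also have "\<dots> = (\<Sum>s = 1..l. y (sink_edge l s) * (unit_vec s t - unit_vec (l + 1) t))"
      by (subst sum.reindex) (auto simp: inj_on_def sink_edge_def)
    also have "\<dots> = (\<Sum>s = 1..l. if s = t then y (sink_edge l s) else 0)"
      using t by (intro sum.cong) (auto simp: unit_vec_def)
    finally show ?thesis using t by simp
  qed
  then have y0: "y f = 0" for f using in0 out0 unfolding index_eq by blast
  show ?thesis
  proof
    fix f
    show "x f = flow_of l es h (\<lambda>r. x (es ! r)) f" using y0[of f] unfolding y_def by simp
  qed
qed

lemma flow_of_cong: "(\<And>r. r < length es \<Longrightarrow> c r = d r) \<Longrightarrow> flow_of l es h c = flow_of l es h d"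
  by (simp add: flow_of_def)

text \<open>Reading off the values on the edges outside the star inverts the coordinates, over the reals and
  over the integers.\<close>

lemma lattice_basis: "is_lattice_basis (flow_lattice l m) (length es) (\<lambda>r. sink_cycle l (es ! r))"
proof -
  let ?h = "\<lambda>t. 0 :: real" and ?A = "{..<length es} \<rightarrow>\<^sub>E (UNIV :: int set)"
  have bal: "balanced ?h" by (simp add: balanced_def)
  have eq: "(\<lambda>c f. \<Sum>r<length es. of_int (c r) * sink_cycle l (es ! r) f) =
      (\<lambda>c. flow_of l es ?h (\<lambda>r. real_of_int (c r)))"
    by (simp add: flow_of_def sink_flow_def)
  have "bij_betw (\<lambda>c. flow_of l es ?h (\<lambda>r. real_of_int (c r))) ?A (flow_lattice l m)"
  proof (rule bij_betw_byWitness[where f' = "\<lambda>x. restrict (\<lambda>r. \<lfloor>x (es ! r)\<rfloor>) {..<length es}"])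
    show "\<forall>c\<in>?A. restrict (\<lambda>r. \<lfloor>flow_of l es ?h (\<lambda>r. real_of_int (c r)) (es ! r)\<rfloor>) {..<length es} = c"
    proof
      fix c assume "c \<in> ?A"
      then show "restrict (\<lambda>r. \<lfloor>flow_of l es ?h (\<lambda>r. real_of_int (c r)) (es ! r)\<rfloor>) {..<length es} = c"
        by (intro ext) (auto simp: restrict_def flow_of_inner PiE_def extensional_def)
    qed
    show "\<forall>x\<in>flow_lattice l m. flow_of l es ?h
        (\<lambda>r. real_of_int (restrict (\<lambda>r. \<lfloor>x (es ! r)\<rfloor>) {..<length es} r)) = x"
    proof
      fix x assume x: "x \<in> flow_lattice l m"
      then have "flow_of l es ?h (\<lambda>r. real_of_int (restrict (\<lambda>r. \<lfloor>x (es ! r)\<rfloor>) {..<length es} r)) =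
          flow_of l es ?h (\<lambda>r. x (es ! r))"
      proof (intro flow_of_cong)
        fix r assume r: "r < length es"
        have "x (es ! r) \<in> \<int>" using x by (simp only: flow_lattice_def mem_Collect_eq)
        then show "real_of_int (restrict (\<lambda>r. \<lfloor>x (es ! r)\<rfloor>) {..<length es} r) = x (es ! r)"
          using r by (auto elim!: Ints_cases)
      qed
      also have "\<dots> = x" using flow_space_eq_flow_of[OF bal, of x] x by (auto simp: flow_lattice_def)
      finally show "flow_of l es ?h
        (\<lambda>r. real_of_int (restrict (\<lambda>r. \<lfloor>x (es ! r)\<rfloor>) {..<length es} r)) = x" .
    qed
    show "(\<lambda>c. flow_of l es ?h (\<lambda>r. real_of_int (c r))) ` ?A \<subseteq> flow_lattice l m"
    proof (intro image_subsetI)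
      fix c :: "nat \<Rightarrow> int"
      have "flow_of l es ?h (\<lambda>r. real_of_int (c r)) f \<in> \<int>" for f
        unfolding flow_of_def sink_flow_def sink_cycle_def
        by (intro Ints_add Ints_sum Ints_mult Ints_diff) auto
      then show "flow_of l es ?h (\<lambda>r. real_of_int (c r)) \<in> flow_lattice l m"
        using flow_of_in_flow_space[OF bal] by (simp add: flow_lattice_def)
    qed
    show "(\<lambda>x. restrict (\<lambda>r. \<lfloor>x (es ! r)\<rfloor>) {..<length es}) ` flow_lattice l m \<subseteq> ?A"
      by (intro image_subsetI) (simp add: PiE_def Pi_def)
  qed
  then show ?thesis unfolding is_lattice_basis_def eq .
qed

text \<open>Nonnegativity on the star edges is the condition that no vertex sends out more than it has.\<close>

lemma polytope_coordinates:
  assumes "balanced h"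
  shows "{c \<in> {..<length es} \<rightarrow>\<^sub>E UNIV.
      (\<lambda>e. sink_flow l h e + (\<Sum>r<length es. c r * sink_cycle l (es ! r) e)) \<in> flow_polytope l m h} =
    region l es h"
proof -
  have "flow_of l es h c \<in> flow_polytope l m h \<longleftrightarrow>
      (\<forall>r<length es. 0 \<le> c r) \<and> (\<forall>t\<in>{1..l}. outflow es c t \<le> h t + inflow es c t)" for c
  proof -
    have "flow_of l es h c \<in> flow_polytope l m h \<longleftrightarrow>
        (\<forall>f\<in>set es. 0 \<le> flow_of l es h c f) \<and> (\<forall>t\<in>{1..l}. 0 \<le> flow_of l es h c (sink_edge l t))"
      using flow_of_in_flow_space[OF assms] unfolding flow_polytope_def index_eq set_es[symmetric] by auto
    also have "\<dots> \<longleftrightarrow> (\<forall>r<length es. 0 \<le> c r) \<and> (\<forall>t\<in>{1..l}. outflow es c t \<le> h t + inflow es c t)"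
      by (simp add: flow_of_sink_edge all_set_conv_all_nth flow_of_inner)
    finally show ?thesis .
  qed
  then show ?thesis unfolding region_def flow_of_def[symmetric] by auto
qed

lemma flow_volume_eq:
  assumes "balanced h" "has_flow_volume l m h V"
  shows "V = enn2real (region_vol l es h)"
proof -
  have "flow_of l es h (\<lambda>r. 0) \<in> flow_space l m h" using assms(1) by (rule flow_of_in_flow_space)
  then have "sink_flow l h \<in> flow_space l m h" by (simp add: flow_of_def)
  then have "measure (\<Pi>\<^sub>M r\<in>{..<length es}. lborel) {c \<in> {..<length es} \<rightarrow>\<^sub>E UNIV.
      (\<lambda>e. sink_flow l h e + (\<Sum>r<length es. c r * sink_cycle l (es ! r) e)) \<in> flow_polytope l m h} = V"
    using assms(2) lattice_basis unfolding has_flow_volume_def by blast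
  then show ?thesis by (simp add: polytope_coordinates[OF assms(1)] region_vol_def measure_def)
qed

end

lemma root_comb_eq:
  assumes "1 \<le> l"
  shows "root_comb l q t = (if t \<in> {1..l} then q t else 0) - (if t \<in> {2..l + 1} then q (t - 1) else 0)"
proof -
  have "root_comb l q t = (\<Sum>i = 1..l. if i = t then q i else 0) - (\<Sum>i = 1..l. if i + 1 = t then q i else 0)"
    unfolding root_comb_def simple_root_def unit_vec_def sum_subtractf[symmetric]
    by (intro sum.cong) auto
  also have "(\<Sum>i = 1..l. if i = t then q i else 0) = (if t \<in> {1..l} then q t else 0)" by simp
  also have "(\<Sum>i = 1..l. if i + 1 = t then q i else 0) = (\<Sum>i = 1..l. if i = t - 1 \<and> t \<noteq> 0 then q i else 0)"
    by (intro sum.cong) auto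
  also have "\<dots> = (if t \<in> {2..l + 1} then q (t - 1) else 0)"
    by (cases "t = 0") auto
  finally show ?thesis .
qed

lemma partial_sum_root_comb:
  assumes "1 \<le> l" "k \<in> {1..l}"
  shows "partial_sum 1 (root_comb l q) k = q k"
proof -
  have "1 \<le> k" using assms by simp
  then have "k \<le> l \<longrightarrow> partial_sum 1 (root_comb l q) k = q k"
  proof (induction k rule: dec_induct)
    case base
    then show ?case using assms(1) by (simp add: partial_sum_def root_comb_eq)
  next
    case (step n)
    then show ?case using assms(1) by (auto simp: partial_sum_def root_comb_eq)
  qed
  then show ?thesis using assms by simp
qed

lemma (in star_coordinates) balanced_root_comb:
  assumes "1 \<le> l"
  shows "balanced (root_comb l q)"
  unfolding balanced_def
proof
  fix t
  have s: "(\<Sum>s = 1..l. root_comb l q s) = q l"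
    using partial_sum_root_comb[of l l q] assms by (simp add: partial_sum_def)
  have "(\<Sum>s = 1..l. root_comb l q s * (unit_vec s t - unit_vec (l + 1) t)) =
      (\<Sum>s = 1..l. if s = t then root_comb l q s else 0) - (\<Sum>s = 1..l. root_comb l q s) * unit_vec (l + 1) t"
    unfolding sum_distrib_right sum_subtractf[symmetric]
    by (intro sum.cong refl) (auto simp: unit_vec_def algebra_simps)
  also have "\<dots> = root_comb l q t"
    unfolding s using assms by (auto simp: root_comb_eq unit_vec_def)
  finally show "(\<Sum>s = 1..l. root_comb l q s * (unit_vec s t - unit_vec (l + 1) t)) = root_comb l q t" .
qed

lemma root_comb_nonneg:
  assumes "1 \<le> l" "q \<in> nice_coords l" "t \<in> {1..l}"
  shows "0 \<le> root_comb l q t"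
proof (cases "t = 1")
  case True
  then show ?thesis using assms by (simp add: root_comb_eq nice_coords_def)
next
  case False
  then have "1 \<le> t - 1 \<and> t - 1 < l" "t - 1 + 1 = t" using assms(3) by auto
  then have "q (t - 1) < q t" using assms(2) unfolding nice_coords_def mem_Collect_eq by metis
  then show ?thesis using assms False by (simp add: root_comb_eq)
qed

section \<open>The annihilator ideal\<close>

lemma carrier_mpoly_ring: "carrier (mpoly_ring l) = Pol {1..l}"
  by (simp add: mpoly_ring_def Pol_def)

lemma ring_mpoly_ring: "ring (mpoly_ring l)"
proof (intro ringI abelian_groupI monoidI)
  fix x assume "x \<in> carrier (mpoly_ring l)"
  then show "\<exists>y\<in>carrier (mpoly_ring l). y \<oplus>\<^bsub>mpoly_ring l\<^esub> x = \<zero>\<^bsub>mpoly_ring l\<^esub>"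
    unfolding carrier_mpoly_ring by (intro bexI[of _ "- x"]) (auto simp: mpoly_ring_def Pol_uminus)
qed (unfold carrier_mpoly_ring, auto simp: mpoly_ring_def Pol_add Pol_mult algebra_simps)

lemma ideal_Ann: "ideal (Ann l v) (mpoly_ring l)"
proof (rule idealI[OF ring_mpoly_ring])
  interpret g: group "add_monoid (mpoly_ring l)"
    using ring.is_abelian_group[OF ring_mpoly_ring] by (rule abelian_group.a_group)
  show "subgroup (Ann l v) (add_monoid (mpoly_ring l))"
  proof (rule g.subgroupI)
    show "Ann l v \<subseteq> carrier (add_monoid (mpoly_ring l))"
      by (auto simp: Ann_def)
    have "0 \<in> Ann l v" by (simp add: Ann_def carrier_mpoly_ring)
    then show "Ann l v \<noteq> {}" by blast
  next
    fix x assume x: "x \<in> Ann l v"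
    have "inv\<^bsub>add_monoid (mpoly_ring l)\<^esub> x = - x"
    proof (rule g.inv_equality)
      show "- x \<otimes>\<^bsub>add_monoid (mpoly_ring l)\<^esub> x = \<one>\<^bsub>add_monoid (mpoly_ring l)\<^esub>"
        by (simp add: mpoly_ring_def)
    qed (use x in \<open>auto simp: Ann_def carrier_mpoly_ring Pol_uminus\<close>)
    then show "inv\<^bsub>add_monoid (mpoly_ring l)\<^esub> x \<in> Ann l v"
      using x by (simp add: Ann_def carrier_mpoly_ring Pol_uminus diffop_uminus_left)
  next
    fix x y assume "x \<in> Ann l v" "y \<in> Ann l v"
    then show "x \<otimes>\<^bsub>add_monoid (mpoly_ring l)\<^esub> y \<in> Ann l v"
      unfolding Ann_def carrier_mpoly_ring by (simp add: mpoly_ring_def Pol_add diffop_add_left)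
  qed
next
  fix D E assume "D \<in> Ann l v" "E \<in> carrier (mpoly_ring l)"
  then have "E * D \<in> Ann l v"
    unfolding Ann_def carrier_mpoly_ring by (simp add: Pol_mult diffop_mult)
  then show "E \<otimes>\<^bsub>mpoly_ring l\<^esub> D \<in> Ann l v" "D \<otimes>\<^bsub>mpoly_ring l\<^esub> E \<in> Ann l v"
    by (simp_all add: mpoly_ring_def mult.commute)
qed

lemma ideal_combination:
  assumes I: "ideal I (mpoly_ring l)" and "\<And>k. k \<in> A \<Longrightarrow> E k \<in> Pol {1..l}" "\<And>k. k \<in> A \<Longrightarrow> g k \<in> I"
  shows "(\<Sum>k\<in>A. E k * g k) \<in> I"
proof -
  interpret ideal I "mpoly_ring l" by (rule I)
  have 0: "0 \<in> I" using additive_subgroup.zero_closed[OF is_additive_subgroup] by (simp add: mpoly_ring_def)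
  have add: "x + y \<in> I" if "x \<in> I" "y \<in> I" for x y
    using additive_subgroup.a_closed[OF is_additive_subgroup that] by (simp add: mpoly_ring_def)
  have mult: "x * y \<in> I" if "y \<in> I" "x \<in> Pol {1..l}" for x y
    using I_l_closed[OF that(1), of x] that(2) by (simp add: mpoly_ring_def Pol_def)
  show ?thesis
    using assms(2,3) by (induction A rule: infinite_finite_induct) (auto simp del: One_nat_def intro: 0 add mult)
qed

theorem theorem3p8:
  fixes l :: nat and m :: "nat \<Rightarrow> nat \<Rightarrow> nat" and v :: mpolynomial
  assumes l: "1 \<le> l"
    and m: "\<And>i j. 1 \<le> i \<Longrightarrow> i < j \<Longrightarrow> j \<le> l + 1 \<Longrightarrow> 0 < m i j"
    and v: "v \<in> carrier (mpoly_ring l)"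
    and volume: "\<And>q. q \<in> nice_coords l \<Longrightarrow> has_flow_volume l m (root_comb l q) (meval q v)"
  shows "Ann l v =
    genideal (mpoly_ring l)
      ((\<lambda>i. \<Prod>j = i + 1..l + 1. (\<Sum>r = i..j - 1. mvar r) ^ m i j) ` {1..l})"
proof -
  obtain es F where es: "distinct es" "set es = inner_edges l m 1" and F: "F \<in> Pol {1..l}"
    and rep: "represents l 1 es F"
    and kill: "\<And>k. k \<in> {1..l} \<Longrightarrow> diffop (vertex_op l m k) F = 0"
    and gen: "\<And>D. D \<in> Pol {1..l} \<Longrightarrow> diffop D F = 0 \<Longrightarrow>
      \<exists>E. (\<forall>k. E k \<in> Pol {1..l}) \<and> D = (\<Sum>k = 1..l. E k * vertex_op l m k)"
    using volume_polynomial[where i = 1 and l = l and m = m] m by (auto simp del: One_nat_def)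
  interpret star_coordinates l m es
    by standard (use m es in auto)
  have "meval q v = meval q F" if q: "q \<in> nice_coords l" for q
  proof -
    let ?h = "root_comb l q"
    have "0 \<le> meval (partial_sum 1 ?h) F" "region_vol l es ?h = ennreal (meval (partial_sum 1 ?h) F)"
      using rep root_comb_nonneg[OF l q] by (auto simp: represents_def)
    moreover have "meval (partial_sum 1 ?h) F = meval q F"
      using partial_sum_root_comb[OF l] by (intro meval_cong[OF F]) simp
    ultimately show ?thesis
      using flow_volume_eq[OF balanced_root_comb[OF l] volume[OF q]] by simp
  qed
  then have "v - F = 0"
    using v F by (intro zero_on_nice_coords[of _ l]) (auto simp: carrier_mpoly_ring Pol_diff meval_diff)
  then have vF: "v = F" by simp
  let ?g = "\<lambda>i. \<Prod>j = i + 1..l + 1. (\<Sum>r = i..j - 1. mvar r) ^ m i j"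
  have g: "?g = vertex_op l m" by (intro ext) (simp only: vertex_op_def root_op_def)
  show ?thesis
  proof
    show "Ann l v \<subseteq> genideal (mpoly_ring l) (?g ` {1..l})"
      unfolding g genideal_def
    proof (intro subsetI InterI, elim CollectE conjE)
      fix D I assume "D \<in> Ann l v" and I: "ideal I (mpoly_ring l)" "vertex_op l m ` {1..l} \<subseteq> I"
      then obtain E where "\<forall>k. E k \<in> Pol {1..l}" "D = (\<Sum>k = 1..l. E k * vertex_op l m k)"
        using gen[of D] by (auto simp: Ann_def carrier_mpoly_ring vF)
      then show "D \<in> I" using I by (auto intro!: ideal_combination)
    qed
    have "vertex_op l m k \<in> Ann l v" if k: "k \<in> {1..l}" for k
    proof -
      have "vertex_op l m k \<in> Pol {1..l}"
        using Pol_vertex_op[of l m k] k by (auto intro: Pol_mono[rotated])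
      then show ?thesis using kill[OF k] by (simp add: Ann_def carrier_mpoly_ring vF)
    qed
    then show "genideal (mpoly_ring l) (?g ` {1..l}) \<subseteq> Ann l v"
      unfolding g genideal_def using ideal_Ann by blast
  qed
qed

end
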